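(* Let $\Omega=\mathbb{R}^d/\mathbb{Z}^d$, let $h:\Omega\to\mathbb{R}$ be continuous with $\hat h(\xi)\ne0$ for all $\xi\in\mathbb{Z}^d$, and let $\pi$ be a probability measure on $\Omega$. Let $\mathcal{A}_n$ and $\mathcal{M}_N$ be two (nonempty) TV-bounded weakly closed sets of finite signed measures on $\Omega$ such that $\mathcal{H}_{\mathcal{N}_h}(\mathcal{A}_n,\mathcal{M}_N)\leq\varepsilon$. Let $\mu_n^*$ be a projection of $\pi$ on $\mathcal{A}_n$, i.e. a minimizer of $\mu\mapsto\mathcal{N}_h(\pi-\mu)$ over $\mathcal{A}_n$. Then there is a point $\mu_N\in\mathcal{M}_N$ such that $$\mathcal{N}_h(\mu_n^*-\mu_N)\leq\varepsilon\quad\text{and}\quad \mathcal{N}_h(\pi-\mu_N)\leq\inf_{\mu\in\mathcal{M}_N}\mathcal{N}_h(\pi-\mu)+2\varepsilon.$$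
   Context: $\mathcal{N}_h(\mu)=\|h\star\mu\|_{L^2(\Omega)}$ with $h\star\mu(x)=\int_\Omega h(x-y)\,d\mu(y)$; $\hat h(\xi)=\int_\Omega e^{-2i\pi\langle\xi,x\rangle}h(x)\,dx$. TV-bounded means bounded for the total variation norm. Weakly closed refers to the topology of convergence against continuous functions on $\Omega$. The Hausdorff distance is $$\mathcal{H}_{\mathcal{N}_h}(X,Y)=\max\Big\{\sup_{x\in X}\inf_{y\in Y}\mathcal{N}_h(x-y),\ \sup_{y\in Y}\inf_{x\in X}\mathcal{N}_h(y-x)\Big\}.$$ *)

theory Defs
  imports "HOL-Probability.Probability"
begin

section \<open>The torus\<close>

quotient_type 'd torus = "real ^ ('d::finite)" / "\<lambda>x y. \<forall>i. x $ i - y $ i \<in> \<int>"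
  morphisms rep_torus to_torus
proof (rule equivpI)
  show "symp (\<lambda>(x::real^'d) y. \<forall>i. x $ i - y $ i \<in> \<int>)"
  proof (rule sympI, rule allI)
    fix x y :: "real^'d" and i
    assume "\<forall>i. x $ i - y $ i \<in> \<int>"
    then have "- (x $ i - y $ i) \<in> \<int>" by (intro Ints_minus) auto
    then show "y $ i - x $ i \<in> \<int>" by simp
  qed
  show "transp (\<lambda>(x::real^'d) y. \<forall>i. x $ i - y $ i \<in> \<int>)"
  proof (rule transpI, rule allI)
    fix x y z :: "real^'d" and i
    assume "\<forall>i. x $ i - y $ i \<in> \<int>" "\<forall>i. y $ i - z $ i \<in> \<int>"
    then have "(x $ i - y $ i) + (y $ i - z $ i) \<in> \<int>" by (intro Ints_add) auto
    then show "x $ i - z $ i \<in> \<int>" by simp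
  qed
qed (simp add: reflp_def)

instantiation torus :: (finite) ab_group_add
begin

lift_definition zero_torus :: "'a torus" is 0 .

lift_definition plus_torus :: "'a torus \<Rightarrow> 'a torus \<Rightarrow> 'a torus" is "(+)"
  by (simp add: add_diff_add)

lift_definition uminus_torus :: "'a torus \<Rightarrow> 'a torus" is "uminus"
  by (metis Ints_minus minus_diff_minus uminus_vec_def vec_lambda_beta)

lift_definition minus_torus :: "'a torus \<Rightarrow> 'a torus \<Rightarrow> 'a torus" is "(-)"
proof -
  fix x y u v :: "real^'a" and i
  assume "\<And>i. x $ i - y $ i \<in> \<int>" "\<And>i. u $ i - v $ i \<in> \<int>"
  then have "(x $ i - y $ i) - (u $ i - v $ i) \<in> \<int>" by (rule Ints_diff)
  then show "(x - u) $ i - (y - v) $ i \<in> \<int>" by (simp add: algebra_simps)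
qed

instance
  by standard (transfer; simp add: algebra_simps)+

end

instantiation torus :: (finite) topological_space
begin

definition open_torus :: "'a torus set \<Rightarrow> bool"
  where "open_torus U \<longleftrightarrow> open (to_torus -` U)"

instance
proof
  show "open (UNIV :: 'a torus set)" by (simp add: open_torus_def)
  show "open (S \<inter> T)" if "open S" "open T" for S T :: "'a torus set"
    using that by (simp add: open_torus_def open_Int)
  show "open (\<Union>K)" if "\<forall>S\<in>K. open S" for K :: "'a torus set set"
    using that by (auto simp: open_torus_def vimage_Union)
qed

end

lemma continuous_to_torus: "continuous_on UNIV to_torus"
  by (simp add: continuous_on_open_vimage open_torus_def)

definition torus_volume :: "('d::finite) torus measure"
  where "torus_volume = distr (restrict_space lborel {x. \<forall>i. 0 \<le> x $ i \<and> x $ i < 1}) borel to_torus"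

text \<open>The character \<open>x \<mapsto> exp (-2 i \<pi> \<langle>\<xi>, x\<rangle>)\<close> indexed by a frequency
  \<open>\<xi>\<close> in the integer lattice.\<close>

lift_definition torus_char :: "int ^ 'd \<Rightarrow> ('d::finite) torus \<Rightarrow> complex"
  is "\<lambda>\<xi> x. exp (- 2 * \<i> * of_real pi * of_real (\<Sum>j\<in>UNIV. of_int (\<xi> $ j) * x $ j))"
proof -
  fix \<xi> :: "int ^ 'd" and x y :: "real ^ 'd"
  assume "\<And>i. x $ i - y $ i \<in> \<int>"
  then have "(\<Sum>j\<in>UNIV. of_int (\<xi> $ j) * (x $ j - y $ j)) \<in> \<int>"
    by (intro Ints_sum Ints_mult) auto
  then obtain k :: int where "(\<Sum>j\<in>UNIV. of_int (\<xi> $ j) * (x $ j - y $ j)) = of_int k"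
    by (auto elim: Ints_cases)
  then have k: "(\<Sum>j\<in>UNIV. of_int (\<xi> $ j) * x $ j)
      = (\<Sum>j\<in>UNIV. of_int (\<xi> $ j) * y $ j) + of_int k"
    by (simp add: right_diff_distrib sum_subtractf)
  show "exp (- 2 * \<i> * of_real pi * of_real (\<Sum>j\<in>UNIV. of_int (\<xi> $ j) * x $ j))
      = exp (- 2 * \<i> * of_real pi * of_real (\<Sum>j\<in>UNIV. of_int (\<xi> $ j) * y $ j))"
    unfolding k exp_eq by (intro exI[of _ "- k"]) (simp add: algebra_simps)
qed

definition torus_fourier :: "(('d::finite) torus \<Rightarrow> real) \<Rightarrow> int ^ 'd \<Rightarrow> complex"
  where "torus_fourier h \<xi> = (LINT x|torus_volume. torus_char \<xi> x * complex_of_real (h x))"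


section \<open>Finite signed Borel measures\<close>

text \<open>Values outside the Borel sets are fixed to be 0, so that equality of signed measures is
  equality on Borel sets.\<close>

typedef (overloaded) 'a signed_measure =
  "{\<nu> :: 'a::topological_space set \<Rightarrow> real.
      (\<forall>A. A \<notin> sets borel \<longrightarrow> \<nu> A = 0) \<and>
      (\<forall>F :: nat \<Rightarrow> 'a set. range F \<subseteq> sets borel \<longrightarrow> disjoint_family F \<longrightarrow>
        (\<lambda>i. \<nu> (F i)) sums \<nu> (\<Union>i. F i))}"
  morphisms smeasure Abs_signed_measure
  by (rule exI[of _ "\<lambda>_. 0"]) simp

setup_lifting type_definition_signed_measure

instantiation signed_measure :: (topological_space) ab_group_add
begin

lift_definition zero_signed_measure :: "'a signed_measure" is "\<lambda>_. 0"
  by simp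

lift_definition plus_signed_measure :: "'a signed_measure \<Rightarrow> 'a signed_measure \<Rightarrow> 'a signed_measure"
  is "\<lambda>\<mu> \<nu> A. \<mu> A + \<nu> A"
  by (simp add: sums_add)

lift_definition uminus_signed_measure :: "'a signed_measure \<Rightarrow> 'a signed_measure"
  is "\<lambda>\<mu> A. - \<mu> A"
  by (simp add: sums_minus)

lift_definition minus_signed_measure :: "'a signed_measure \<Rightarrow> 'a signed_measure \<Rightarrow> 'a signed_measure"
  is "\<lambda>\<mu> \<nu> A. \<mu> A - \<nu> A"
  by (simp add: sums_diff)

instance
proof
  fix a b c :: "'a signed_measure"
  show "a + b + c = a + (b + c)" by transfer (simp add: add.assoc)
  show "a + b = b + a" by transfer (simp add: add.commute)
  show "0 + a = a" by transfer simp
  show "- a + a = 0" by transfer simp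
  show "a - b = a + - b" by transfer simp
qed

end

text \<open>A finite Borel measure seen as a signed measure; the value on other measures is irrelevant.\<close>

lift_definition signed_of :: "'a::topological_space measure \<Rightarrow> 'a signed_measure"
  is "\<lambda>M A. if finite_measure M \<and> sets M = sets borel \<and> A \<in> sets borel then measure M A else 0"
proof -
  fix M :: "'a measure"
  show "(\<forall>A. A \<notin> sets borel \<longrightarrow>
          (if finite_measure M \<and> sets M = sets borel \<and> A \<in> sets borel then measure M A else 0) = 0) \<and>
        (\<forall>F :: nat \<Rightarrow> 'a set. range F \<subseteq> sets borel \<longrightarrow> disjoint_family F \<longrightarrow>
          (\<lambda>i. if finite_measure M \<and> sets M = sets borel \<and> F i \<in> sets borel then measure M (F i) else 0)
          sums (if finite_measure M \<and> sets M = sets borel \<and> (\<Union>i. F i) \<in> sets borel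
                then measure M (\<Union>i. F i) else 0))"
  proof (cases "finite_measure M \<and> sets M = sets borel")
    case True
    then show ?thesis
      using finite_measure.finite_measure_UNION[of M] by (auto simp: image_subset_iff)
  next
    case False
    then show ?thesis by (simp only: simp_thms if_False if_cancel conj_assoc[symmetric]) simp
  qed
qed

text \<open>The positive part of the Jordan decomposition, \<open>\<nu>\<^sup>+ A = sup {\<nu> B | B \<subseteq> A}\<close>.
  The coercion \<^term>\<open>ennreal\<close> truncates negative values to 0, which is harmless because
  \<open>B = {}\<close> is admissible. The negative part of \<open>\<nu>\<close> is the positive part of \<open>- \<nu>\<close>.\<close>

definition pos_part :: "'a::topological_space signed_measure \<Rightarrow> 'a measure"
  where "pos_part \<nu> = measure_of UNIV (sets borel)
    (\<lambda>A. SUP B\<in>{B \<in> sets borel. B \<subseteq> A}. ennreal (smeasure \<nu> B))"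

definition neg_part :: "'a::topological_space signed_measure \<Rightarrow> 'a measure"
  where "neg_part \<nu> = pos_part (- \<nu>)"

definition total_variation :: "'a::topological_space signed_measure \<Rightarrow> ennreal"
  where "total_variation \<nu> = emeasure (pos_part \<nu>) UNIV + emeasure (neg_part \<nu>) UNIV"

definition tv_bounded :: "'a::topological_space signed_measure set \<Rightarrow> bool"
  where "tv_bounded S \<longleftrightarrow> (\<exists>C::real. \<forall>\<nu>\<in>S. total_variation \<nu> \<le> ennreal C)"

definition signed_integral :: "'a::topological_space signed_measure \<Rightarrow> ('a \<Rightarrow> real) \<Rightarrow> real"
  where "signed_integral \<nu> f = (LINT x|pos_part \<nu>. f x) - (LINT x|neg_part \<nu>. f x)"

text \<open>The coarsest topology for which integration against every continuous function is
  continuous.\<close>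

definition weak_topology :: "'a::topological_space signed_measure topology"
  where "weak_topology = topology_generated_by
    {{\<nu>. signed_integral \<nu> f \<in> U} | f U. continuous_on UNIV f \<and> open U}"


section \<open>The norm and the Hausdorff distance\<close>

definition signed_conv :: "(('d::finite) torus \<Rightarrow> real) \<Rightarrow> 'd torus signed_measure \<Rightarrow> 'd torus \<Rightarrow> real"
  where "signed_conv h \<mu> x = signed_integral \<mu> (\<lambda>y. h (x - y))"

text \<open>The Bochner integral is 0 for non-integrable functions; for continuous \<open>h\<close> the convolution is
  continuous and bounded, so that this convention plays no role.\<close>

definition torus_L2_norm :: "(('d::finite) torus \<Rightarrow> real) \<Rightarrow> real"
  where "torus_L2_norm f = sqrt (LINT x|torus_volume. (f x)\<^sup>2)"

definition conv_norm :: "(('d::finite) torus \<Rightarrow> real) \<Rightarrow> 'd torus signed_measure \<Rightarrow> real"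
  where "conv_norm h \<mu> = torus_L2_norm (signed_conv h \<mu>)"

text \<open>Extended real values avoid the arbitrary supremum of an unbounded set of reals.\<close>

definition hausdorff_distance :: "('a::minus \<Rightarrow> real) \<Rightarrow> 'a set \<Rightarrow> 'a set \<Rightarrow> ereal"
  where "hausdorff_distance N X Y =
    max (SUP x\<in>X. INF y\<in>Y. ereal (N (x - y))) (SUP y\<in>Y. INF x\<in>X. ereal (N (y - x)))"

end

theory Submission
  imports Defs
begin

text \<open>If the infimum of \<open>N (\<mu>' - \<nu>)\<close> over \<open>\<nu> \<in> M\<close> is attained, the claim follows from the triangle
  inequality: \<open>\<mu>'\<close> is optimal in \<open>A\<close>, and every point of \<open>M\<close> is within \<open>\<epsilon>\<close> of \<open>A\<close>. It is attained
  because \<open>M\<close> is weakly sequentially compact and, by dominated convergence, \<open>N\<close> is continuous along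
  weakly convergent TV-bounded sequences. Compactness is obtained without the Riesz representation
  theorem: a space-filling curve onto the torus has a Borel section, so the positive and negative
  parts of the measures are moved to the unit interval by the section, Helly's selection theorem
  is applied there, and the limits are pushed back along the curve.\<close>

section \<open>Jordan decomposition\<close>

text \<open>The bound on the Hausdorff distance only says that infima are at most \<epsilon>,
  possibly without being reached, while the claim leaves no slack; near-minimizers must therefore
  have a limit inside \<open>M\<close>. Measures travel along the section, which only has to be
  Borel, and test functions travel along the curve, which is continuous; tightness on the line is
  automatic because the section takes its values in \<open>{0..1}\<close>. A further obstacle is
  that \<open>signed_integral\<close> is defined by Jordan parts, which are not additive: the limits
  of the positive and of the negative parts may overlap, and then they are not the Jordan parts of
  the limit measure. Linearity of the integral in the measure is therefore proved beforehand,
  through sums over level sets.\<close>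

lemma ennreal_add_le: "ennreal (x + y) \<le> ennreal x + ennreal y"
proof (cases "0 \<le> x \<and> 0 \<le> y")
  case False
  then consider "x \<le> 0" | "y \<le> 0" by linarith
  then show ?thesis by cases (auto simp: ennreal_neg intro!: ennreal_leI)
qed (simp add: ennreal_plus)

lemma smeasure_sums:
  fixes F :: "nat \<Rightarrow> 'a::topological_space set"
  assumes "range F \<subseteq> sets borel" "disjoint_family F"
  shows "(\<lambda>i. smeasure \<nu> (F i)) sums smeasure \<nu> (\<Union>i. F i)"
  using smeasure[of \<nu>] assms by blast

text \<open>A constant sequence of empty sets is disjoint, and a constant series converges only if
  its term is 0.\<close>

lemma smeasure_empty [simp]: "smeasure \<nu> {} = 0"
proof -
  have "(\<lambda>i::nat. smeasure \<nu> {}) sums smeasure \<nu> {}"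
    using smeasure_sums[of "\<lambda>_. {}" \<nu>] by (auto simp: disjoint_family_on_def)
  then show ?thesis
    by (metis sums_summable summable_const_iff)
qed

lemma smeasure_Un:
  assumes "A \<in> sets borel" "B \<in> sets borel" "A \<inter> B = {}"
  shows "smeasure \<nu> (A \<union> B) = smeasure \<nu> A + smeasure \<nu> B"
proof -
  have "range (binaryset A B) \<subseteq> sets borel" "disjoint_family (binaryset A B)"
    using assms by (auto simp: binaryset_def disjoint_family_on_def split: if_splits)
  from smeasure_sums[OF this, of \<nu>] show ?thesis
    using binaryset_sums[of "smeasure \<nu>" A B] by (simp add: UN_binaryset_eq) (rule sums_unique2)
qed

lemma smeasure_Diff:
  assumes "A \<in> sets borel" "B \<in> sets borel" "B \<subseteq> A"
  shows "smeasure \<nu> (A - B) = smeasure \<nu> A - smeasure \<nu> B"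
  using smeasure_Un[of "A - B" B \<nu>] assms by (simp add: Un_absorb2 Int_commute)

lemma smeasure_minus_apply [simp]: "smeasure (\<mu> - \<nu>) A = smeasure \<mu> A - smeasure \<nu> A"
  by transfer simp

lemma smeasure_uminus_apply [simp]: "smeasure (- \<nu>) A = - smeasure \<nu> A"
  by transfer simp

text \<open>The set function inside \<open>pos_part\<close>, named separately because its countable
  additivity has to be known before \<open>pos_part\<close> can be evaluated.\<close>

definition upper_variation :: "'a::topological_space signed_measure \<Rightarrow> 'a set \<Rightarrow> ennreal"
  where "upper_variation \<nu> A = (SUP B\<in>{B \<in> sets borel. B \<subseteq> A}. ennreal (smeasure \<nu> B))"

lemma upper_variation_upper:
  "B \<in> sets borel \<Longrightarrow> B \<subseteq> A \<Longrightarrow> ennreal (smeasure \<nu> B) \<le> upper_variation \<nu> A"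
  unfolding upper_variation_def by (intro SUP_upper) auto

lemma upper_variation_least:
  "(\<And>B. B \<in> sets borel \<Longrightarrow> B \<subseteq> A \<Longrightarrow> ennreal (smeasure \<nu> B) \<le> c) \<Longrightarrow> upper_variation \<nu> A \<le> c"
  unfolding upper_variation_def by (intro SUP_least) auto

lemma upper_variation_mono: "A \<subseteq> B \<Longrightarrow> upper_variation \<nu> A \<le> upper_variation \<nu> B"
  by (intro upper_variation_least upper_variation_upper) auto

lemma upper_variation_empty [simp]: "upper_variation \<nu> {} = 0"
  by (simp add: upper_variation_def cong: conj_cong)

text \<open>Borel witnesses inside \<open>A\<close> and \<open>B\<close> unite to a witness inside
  the union; if one of them has negative measure, it is truncated to 0 and the other witness
  suffices alone. Only the witnesses need to be Borel.\<close>

lemma upper_variation_add_le: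
  assumes "A \<inter> B = {}"
  shows "upper_variation \<nu> A + upper_variation \<nu> B \<le> upper_variation \<nu> (A \<union> B)"
proof -
  have *: "ennreal (smeasure \<nu> C) + ennreal (smeasure \<nu> D) \<le> upper_variation \<nu> (A \<union> B)"
    if "C \<in> sets borel" "C \<subseteq> A" "D \<in> sets borel" "D \<subseteq> B" for C D
  proof -
    have eq: "smeasure \<nu> (C \<union> D) = smeasure \<nu> C + smeasure \<nu> D"
      using that assms by (intro smeasure_Un) auto
    have up: "ennreal (smeasure \<nu> X) \<le> upper_variation \<nu> (A \<union> B)" if "X \<in> {C, D, C \<union> D}" for X
      using that \<open>C \<in> _\<close> \<open>D \<in> _\<close> \<open>C \<subseteq> A\<close> \<open>D \<subseteq> B\<close> by (intro upper_variation_upper) auto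
    show ?thesis
    proof (cases "smeasure \<nu> C \<ge> 0 \<and> smeasure \<nu> D \<ge> 0")
      case True
      then show ?thesis using up[of "C \<union> D"] eq by (simp add: ennreal_plus)
    next
      case False
      then consider "smeasure \<nu> C \<le> 0" | "smeasure \<nu> D \<le> 0" by linarith
      then show ?thesis using up by cases (auto simp: ennreal_neg)
    qed
  qed
  have **: "ennreal (smeasure \<nu> C) + upper_variation \<nu> B \<le> upper_variation \<nu> (A \<union> B)"
    if "C \<in> sets borel" "C \<subseteq> A" for C
    unfolding upper_variation_def[of \<nu> B]
    using * that by (subst ennreal_SUP_add_right) (auto intro!: SUP_least)
  have "upper_variation \<nu> A + upper_variation \<nu> B
      = (SUP C\<in>{C \<in> sets borel. C \<subseteq> A}. ennreal (smeasure \<nu> C) + upper_variation \<nu> B)"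
    unfolding upper_variation_def[of \<nu> A] by (subst ennreal_SUP_add_left[symmetric]) auto
  also have "\<dots> \<le> upper_variation \<nu> (A \<union> B)"
    using ** by (auto intro!: SUP_least)
  finally show ?thesis .
qed

lemma upper_variation_Un_le:
  assumes "A \<in> sets borel" "B \<in> sets borel"
  shows "upper_variation \<nu> (A \<union> B) \<le> upper_variation \<nu> A + upper_variation \<nu> B"
proof (rule upper_variation_least)
  fix C assume C: "C \<in> sets borel" "C \<subseteq> A \<union> B"
  have "smeasure \<nu> C = smeasure \<nu> (C \<inter> A) + smeasure \<nu> (C - A)"
    using smeasure_Un[of "C \<inter> A" "C - A" \<nu>] C assms by (simp add: Int_Diff_disjoint Int_Diff_Un)
  then have "ennreal (smeasure \<nu> C) \<le> ennreal (smeasure \<nu> (C \<inter> A)) + ennreal (smeasure \<nu> (C - A))"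
    by (simp add: ennreal_add_le)
  also have "\<dots> \<le> upper_variation \<nu> A + upper_variation \<nu> B"
    using C assms by (intro add_mono upper_variation_upper) auto
  finally show "ennreal (smeasure \<nu> C) \<le> upper_variation \<nu> A + upper_variation \<nu> B" .
qed

lemma upper_variation_sum_le:
  assumes "disjoint_family (F :: nat \<Rightarrow> _)"
  shows "(\<Sum>i<n. upper_variation \<nu> (F i)) \<le> upper_variation \<nu> (\<Union>i<n. F i)"
proof (induction n)
  case (Suc n)
  have "(\<Union>i<n. F i) \<inter> F n = {}"
    using disjoint_family_onD[OF assms] by (auto simp: set_eq_iff) (metis IntI UNIV_I empty_iff less_irrefl)
  then have "upper_variation \<nu> (\<Union>i<n. F i) + upper_variation \<nu> (F n)
      \<le> upper_variation \<nu> ((\<Union>i<n. F i) \<union> F n)"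
    by (rule upper_variation_add_le)
  also have "(\<Union>i<n. F i) \<union> F n = (\<Union>i<Suc n. F i)"
    by (auto simp: lessThan_Suc)
  finally show ?case
    using order_trans[OF add_right_mono[OF Suc]] by (simp only: sum.lessThan_Suc)
qed simp

lemma ennreal_sum_le: "ennreal (\<Sum>i<n. f i) \<le> (\<Sum>i<n::nat. ennreal (f i))"
proof (induction n)
  case (Suc n)
  show ?case
    using order_trans[OF ennreal_add_le add_right_mono[OF Suc]] by simp
qed simp

text \<open>Finite superadditivity bounds the partial sums. Conversely, a Borel subset of the union
  is cut along the \<open>F i\<close>, and countable additivity of \<nu> adds up the pieces.\<close>

lemma upper_variation_sums:
  assumes F: "range F \<subseteq> sets borel" "disjoint_family (F :: nat \<Rightarrow> _)"
  shows "(\<Sum>i. upper_variation \<nu> (F i)) = upper_variation \<nu> (\<Union>i. F i)"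
proof (rule antisym)
  have "(\<Sum>i<n. upper_variation \<nu> (F i)) \<le> upper_variation \<nu> (\<Union>i. F i)" for n
    by (rule order_trans[OF upper_variation_sum_le[OF F(2)] upper_variation_mono]) auto
  then show "(\<Sum>i. upper_variation \<nu> (F i)) \<le> upper_variation \<nu> (\<Union>i. F i)"
    by (intro suminf_le_const) auto
next
  show "upper_variation \<nu> (\<Union>i. F i) \<le> (\<Sum>i. upper_variation \<nu> (F i))"
  proof (rule upper_variation_least)
    fix B assume B: "B \<in> sets borel" "B \<subseteq> (\<Union>i. F i)"
    have "(\<lambda>i. smeasure \<nu> (B \<inter> F i)) sums smeasure \<nu> (\<Union>i. B \<inter> F i)"
    proof (rule smeasure_sums)
      show "range (\<lambda>i. B \<inter> F i) \<subseteq> sets borel" using B(1) F(1) by auto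
      show "disjoint_family (\<lambda>i. B \<inter> F i)" using F(2) unfolding disjoint_family_on_def by blast
    qed
    also have "(\<Union>i. B \<inter> F i) = B" using B(2) by blast
    finally have "(\<lambda>n. \<Sum>i<n. smeasure \<nu> (B \<inter> F i)) \<longlonglongrightarrow> smeasure \<nu> B"
      by (simp add: sums_def)
    then have "(\<lambda>n. ennreal (\<Sum>i<n. smeasure \<nu> (B \<inter> F i))) \<longlonglongrightarrow> ennreal (smeasure \<nu> B)"
      by (rule tendsto_ennrealI)
    moreover have "ennreal (\<Sum>i<n. smeasure \<nu> (B \<inter> F i)) \<le> (\<Sum>i. upper_variation \<nu> (F i))" for n
    proof -
      note ennreal_sum_le
      also have "(\<Sum>i<n. ennreal (smeasure \<nu> (B \<inter> F i))) \<le> (\<Sum>i<n. upper_variation \<nu> (F i))"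
        using B(1) F(1) by (intro sum_mono upper_variation_upper) auto
      also have "\<dots> \<le> (\<Sum>i. upper_variation \<nu> (F i))"
        by (intro sum_le_suminf) auto
      finally show ?thesis .
    qed
    ultimately show "ennreal (smeasure \<nu> B) \<le> (\<Sum>i. upper_variation \<nu> (F i))"
      by (intro LIMSEQ_le_const2) auto
  qed
qed

section \<open>The positive and negative parts as finite measures\<close>

lemma space_pos_part [simp]: "space (pos_part \<nu>) = UNIV"
  by (simp add: pos_part_def space_measure_of_conv)

lemma sets_pos_part [simp, measurable_cong]: "sets (pos_part \<nu>) = sets borel"
  using sets.sigma_sets_eq[of "borel :: 'a measure"]
  by (simp add: pos_part_def sets_measure_of_conv)

lemma emeasure_pos_part:
  assumes "A \<in> sets borel"
  shows "emeasure (pos_part \<nu>) A = upper_variation \<nu> A"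
  unfolding pos_part_def upper_variation_def[symmetric]
proof (rule emeasure_measure_of[OF refl])
  show "A \<in> sets (measure_of UNIV (sets borel) (upper_variation \<nu>))"
    using assms by simp
  show "positive (sets (measure_of UNIV (sets borel) (upper_variation \<nu>))) (upper_variation \<nu>)"
    by (simp add: positive_def)
  show "countably_additive (sets (measure_of UNIV (sets borel) (upper_variation \<nu>))) (upper_variation \<nu>)"
    using sets.sigma_sets_eq[of "borel :: 'a measure"]
    by (auto simp: countably_additive_def sets_measure_of_conv intro!: upper_variation_sums)
qed auto

text \<open>An infinite upper variation would be inherited by a decreasing sequence of sets along which
  the measure is unbounded, although countable additivity makes it converge there.\<close>

lemma upper_variation_finite: "upper_variation \<nu> UNIV < \<infinity>"
proof (rule ccontr)
  assume "\<not> ?thesis"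
  then have inf: "upper_variation \<nu> UNIV = \<infinity>" by (simp add: less_top[symmetric])
  have step: "\<exists>B. B \<in> sets borel \<and> upper_variation \<nu> B = \<infinity> \<and> B \<subseteq> A \<and> \<bar>smeasure \<nu> B\<bar> \<ge> real (Suc n)"
    if A: "A \<in> sets borel" "upper_variation \<nu> A = \<infinity>" for A n
  proof -
    \<comment> \<open>The additional \<bar>\<nu> A\<bar> makes the measure of \<open>A - B\<close>
      large as well, so either piece may be kept, and subadditivity says that one of them has
      infinite upper variation.\<close>
    have "ennreal (real (Suc n) + \<bar>smeasure \<nu> A\<bar>) < upper_variation \<nu> A"
      using A by simp
    then obtain B where B: "B \<in> sets borel" "B \<subseteq> A"
      and "ennreal (real (Suc n) + \<bar>smeasure \<nu> A\<bar>) < ennreal (smeasure \<nu> B)"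
      unfolding upper_variation_def less_SUP_iff by blast
    then have large: "real (Suc n) + \<bar>smeasure \<nu> A\<bar> < smeasure \<nu> B"
      by (metis ennreal_leI leD leI)
    have "\<bar>smeasure \<nu> (A - B)\<bar> \<ge> real (Suc n)"
      using smeasure_Diff[OF A(1) B, of \<nu>] large by linarith
    moreover have "upper_variation \<nu> B = \<infinity> \<or> upper_variation \<nu> (A - B) = \<infinity>"
      using upper_variation_Un_le[of B "A - B" \<nu>] A B
      by (auto simp: Un_absorb1 top_unique)
    ultimately show ?thesis
      using A B large by (intro exI[of _ "if upper_variation \<nu> B = \<infinity> then B else A - B"]) auto
  qed
  have "\<exists>f. (f 0 \<in> sets borel \<and> upper_variation \<nu> (f 0) = \<infinity>) \<and>
      (\<forall>n. (f (Suc n) \<in> sets borel \<and> upper_variation \<nu> (f (Suc n)) = \<infinity>) \<and>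
        f (Suc n) \<subseteq> f n \<and> \<bar>smeasure \<nu> (f (Suc n))\<bar> \<ge> real (Suc n))"
    using dependent_nat_choice[of "\<lambda>n A. A \<in> sets borel \<and> upper_variation \<nu> A = \<infinity>"
        "\<lambda>n A B. B \<subseteq> A \<and> \<bar>smeasure \<nu> B\<bar> \<ge> real (Suc n)"] inf step
    by (metis sets.top space_borel)
  then obtain f where f0: "f 0 \<in> sets borel"
    and fS: "\<And>n. f (Suc n) \<in> sets borel" "\<And>n. f (Suc n) \<subseteq> f n"
      "\<And>n. \<bar>smeasure \<nu> (f (Suc n))\<bar> \<ge> real (Suc n)"
    by auto
  have fb: "f n \<in> sets borel" for n using f0 fS by (cases n) auto
  have dec: "decseq f" using fS(2) by (rule decseq_SucI)
  \<comment> \<open>The measures of these disjoint differences form a telescoping series; its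
    convergence makes \<open>smeasure \<nu> (f n)\<close> converge, against its growth.\<close>
  have "disjoint_family (\<lambda>n. f n - f (Suc n))"
    unfolding disjoint_family_on_def
  proof (intro ballI impI)
    fix m n :: nat assume "m \<noteq> n"
    then show "(f m - f (Suc m)) \<inter> (f n - f (Suc n)) = {}"
      using decseqD[OF dec, of "Suc m" n] decseqD[OF dec, of "Suc n" m] by (cases m n rule: linorder_cases) auto
  qed
  then have "(\<lambda>n. smeasure \<nu> (f n - f (Suc n))) sums smeasure \<nu> (\<Union>n. f n - f (Suc n))"
    using fb by (intro smeasure_sums) auto
  then have "summable (\<lambda>n. smeasure \<nu> (f n) - smeasure \<nu> (f (Suc n)))"
    using smeasure_Diff[OF fb fb fS(2)] by (auto simp: sums_iff)
  then have "convergent (\<lambda>n. smeasure \<nu> (f 0) - smeasure \<nu> (f n))"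
    by (simp only: summable_iff_convergent sum_lessThan_telescope'[of "\<lambda>n. smeasure \<nu> (f n)"])
  then have "convergent (\<lambda>n. smeasure \<nu> (f n))"
    using convergent_diff[OF convergent_const[of "smeasure \<nu> (f 0)"]] by fastforce
  then obtain K where K: "\<And>n. \<bar>smeasure \<nu> (f n)\<bar> \<le> K"
    by (metis BseqE convergent_imp_Bseq real_norm_def)
  obtain n where "K < real (Suc n)"
    using reals_Archimedean2 by (metis less_Suc_eq of_nat_less_iff less_trans)
  then show False using K[of "Suc n"] fS(3)[of n] by linarith
qed

lemma finite_measure_pos_part: "finite_measure (pos_part \<nu>)"
  using upper_variation_finite[of \<nu>] by (intro finite_measureI) (simp add: emeasure_pos_part)

lemma finite_measure_neg_part: "finite_measure (neg_part \<nu>)"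
  by (simp add: neg_part_def finite_measure_pos_part)

lemma sets_neg_part [simp, measurable_cong]: "sets (neg_part \<nu>) = sets borel"
  by (simp add: neg_part_def)

lemma space_neg_part [simp]: "space (neg_part \<nu>) = UNIV"
  by (simp add: neg_part_def)

text \<open>No Hahn decomposition is used. For \<open>B\<close> inside \<open>A\<close>, \<nu> of
  \<open>B\<close> is \<nu> of \<open>A\<close> plus - \<nu> of \<open>A - B\<close>, so a supremum
  over \<open>B\<close> is bounded through the complements; applying this to \<nu> and to - \<nu>
  gives both inequalities.\<close>

lemma smeasure_eq_pos_minus_neg:
  assumes A: "A \<in> sets borel"
  shows "smeasure \<nu> A = measure (pos_part \<nu>) A - measure (neg_part \<nu>) A"
proof -
  interpret P: finite_measure "pos_part \<nu>" by (rule finite_measure_pos_part)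
  interpret N: finite_measure "neg_part \<nu>" by (rule finite_measure_neg_part)
  have *: "measure (pos_part \<nu>) A \<le> measure (pos_part (- \<nu>)) A + smeasure \<nu> A" for \<nu>
  proof -
    interpret finite_measure "pos_part (- \<nu>)" by (rule finite_measure_pos_part)
    have le: "smeasure \<nu> B \<le> measure (pos_part (- \<nu>)) A + smeasure \<nu> A"
      if B: "B \<in> sets borel" "B \<subseteq> A" for B
    proof -
      have "ennreal (smeasure (- \<nu>) (A - B)) \<le> upper_variation (- \<nu>) A"
        using A B by (intro upper_variation_upper) auto
      also have "\<dots> = ennreal (measure (pos_part (- \<nu>)) A)"
        using A by (simp add: emeasure_pos_part[symmetric] emeasure_eq_measure)
      finally have "smeasure (- \<nu>) (A - B) \<le> measure (pos_part (- \<nu>)) A"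
        using measure_nonneg[of "pos_part (- \<nu>)" A] by (auto simp: ennreal_le_iff2)
      then show ?thesis using smeasure_Diff[OF A B, of \<nu>] by simp
    qed
    have "emeasure (pos_part \<nu>) A \<le> ennreal (measure (pos_part (- \<nu>)) A + smeasure \<nu> A)"
      unfolding emeasure_pos_part[OF A] by (intro upper_variation_least ennreal_leI le)
    moreover have "0 \<le> measure (pos_part (- \<nu>)) A + smeasure \<nu> A"
      using le[of "{}"] by simp
    ultimately show ?thesis
      by (simp add: finite_measure.emeasure_eq_measure[OF finite_measure_pos_part])
  qed
  show ?thesis
    using *[of \<nu>] *[of "- \<nu>"] by (simp add: neg_part_def)
qed

section \<open>The integral against a signed measure\<close>

text \<open>Linear in the set function \<open>m\<close>, which need not be a measure; this makes the integral linear in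
  the signed measure.\<close>

definition level_sum :: "('a set \<Rightarrow> real) \<Rightarrow> ('a \<Rightarrow> real) \<Rightarrow> nat \<Rightarrow> nat \<Rightarrow> real"
  where "level_sum m f C n = (\<Sum>j\<in>{- int (Suc n * C)..int (Suc n * C)}.
    of_int j / real (Suc n) * m {x. \<lfloor>real (Suc n) * f x\<rfloor> = j})"

lemma level_sum_diff: "level_sum (\<lambda>A. m A - m' A) f C n = level_sum m f C n - level_sum m' f C n"
  by (simp add: level_sum_def right_diff_distrib sum_subtractf)

lemma level_sum_cong:
  assumes "f \<in> borel_measurable borel" "\<And>A. A \<in> sets borel \<Longrightarrow> m A = m' A"
  shows "level_sum m f C n = level_sum m' f C n"
proof -
  have "{x. \<lfloor>real (Suc n) * f x\<rfloor> = j} \<in> sets borel" for j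
    using assms(1) by measurable
  then show ?thesis
    unfolding level_sum_def using assms(2) by simp
qed

lemma floor_scaled_near: "\<bar>of_int \<lfloor>real (Suc n) * t\<rfloor> / real (Suc n) - t\<bar> \<le> 1 / real (Suc n)"
proof -
  have "of_int \<lfloor>real (Suc n) * t\<rfloor> / real (Suc n) - t
      = (of_int \<lfloor>real (Suc n) * t\<rfloor> - real (Suc n) * t) / real (Suc n)"
    by (simp add: diff_divide_distrib del: of_nat_Suc)
  also have "\<bar>\<dots>\<bar> \<le> 1 / real (Suc n)"
    unfolding abs_divide abs_of_nat by (intro divide_right_mono) linarith+
  finally show ?thesis .
qed

text \<open>The bound \<open>C\<close> puts the floor into the index range of
  \<open>level_sum\<close>, so exactly one summand survives. Integrating this identity turns a
  rounded function into a level sum.\<close>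

lemma floor_scaled_eq_sum:
  assumes "\<bar>t\<bar> \<le> real C"
  shows "of_int \<lfloor>real (Suc n) * t\<rfloor> / real (Suc n) = (\<Sum>j\<in>{- int (Suc n * C)..int (Suc n * C)}.
    of_int j / real (Suc n) * of_bool (\<lfloor>real (Suc n) * t\<rfloor> = j))"
proof -
  have "\<bar>real (Suc n) * t\<bar> \<le> real (Suc n) * real C"
    using assms by (simp only: abs_mult abs_of_nat mult_left_mono of_nat_0_le_iff)
  then have le: "\<bar>real (Suc n) * t\<bar> \<le> of_int (int (Suc n * C))"
    unfolding of_int_of_nat_eq by (simp only: of_nat_mult)
  then have mem: "\<lfloor>real (Suc n) * t\<rfloor> \<in> {- int (Suc n * C)..int (Suc n * C)}"
    by (simp only: atLeastAtMost_iff) linarith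
  have "(\<Sum>j\<in>{- int (Suc n * C)..int (Suc n * C)}.
      of_int j / real (Suc n) * of_bool (\<lfloor>real (Suc n) * t\<rfloor> = j))
    = (\<Sum>j\<in>{- int (Suc n * C)..int (Suc n * C)}.
      if j = \<lfloor>real (Suc n) * t\<rfloor> then of_int j / real (Suc n) else 0)"
    by (intro sum.cong refl) (simp del: of_nat_Suc)
  also have "\<dots> = of_int \<lfloor>real (Suc n) * t\<rfloor> / real (Suc n)"
    using mem by (simp only: sum.delta finite_atLeastAtMost_int if_True)
  finally show ?thesis by (rule sym)
qed

text \<open>A level sum is the integral of \<open>f\<close> rounded down to multiples of
  \<open>1 / real (Suc n)\<close>. The rounding error is at most 1, whence the dominating constant
  \<open>real C + 1\<close>.\<close>

lemma level_sum_tendsto_integral: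
  fixes f :: "'a::topological_space \<Rightarrow> real"
  assumes "finite_measure P" and sets [measurable_cong]: "sets P = sets borel"
    and f [measurable]: "f \<in> borel_measurable borel" and C: "\<And>x. \<bar>f x\<bar> \<le> real C"
  shows "level_sum (measure P) f C \<longlonglongrightarrow> integral\<^sup>L P f"
proof -
  interpret finite_measure P by fact
  have space: "space P = UNIV"
    using sets_eq_imp_space_eq[OF sets] by simp
  have eq: "level_sum (measure P) f C n = (LINT x|P. of_int \<lfloor>real (Suc n) * f x\<rfloor> / real (Suc n))" for n
  proof -
    define L where "L j = {x. \<lfloor>real (Suc n) * f x\<rfloor> = j}" for j
    have "L j \<in> sets borel" for j
      unfolding L_def by measurable
    then have L: "L j \<in> sets P" for j
      by (simp only: sets)
    have "(LINT x|P. of_int \<lfloor>real (Suc n) * f x\<rfloor> / real (Suc n))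
        = (LINT x|P. (\<Sum>j\<in>{- int (Suc n * C)..int (Suc n * C)}. of_int j / real (Suc n) * indicator (L j) x))"
      unfolding floor_scaled_eq_sum[OF C] L_def indicator_def mem_Collect_eq ..
    also have "\<dots> = (\<Sum>j\<in>{- int (Suc n * C)..int (Suc n * C)}. LINT x|P. of_int j / real (Suc n) * indicator (L j) x)"
      using L by (intro Bochner_Integration.integral_sum integrable_mult_right integrable_real_indicator)
        (auto simp: emeasure_eq_measure)
    also have "\<dots> = (\<Sum>j\<in>{- int (Suc n * C)..int (Suc n * C)}. of_int j / real (Suc n) * measure P (L j))"
      using L by (intro sum.cong refl) (simp add: space del: of_nat_Suc)
    finally show ?thesis
      unfolding level_sum_def L_def by (rule sym)
  qed
  have "(\<lambda>n. LINT x|P. of_int \<lfloor>real (Suc n) * f x\<rfloor> / real (Suc n)) \<longlonglongrightarrow> (LINT x|P. f x)"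
  proof (rule integral_dominated_convergence[where w = "\<lambda>_. real C + 1"])
    have "(\<lambda>n. of_int \<lfloor>real (Suc n) * f x\<rfloor> / real (Suc n)) \<longlonglongrightarrow> f x" for x
    proof (rule LIM_zero_cancel, rule Lim_null_comparison[OF always_eventually LIMSEQ_Suc[OF lim_1_over_n]], rule allI)
      show "norm (of_int \<lfloor>real (Suc n) * f x\<rfloor> / real (Suc n) - f x) \<le> 1 / real (Suc n)" for n
        unfolding real_norm_def by (rule floor_scaled_near)
    qed
    then show "AE x in P. (\<lambda>n. of_int \<lfloor>real (Suc n) * f x\<rfloor> / real (Suc n)) \<longlonglongrightarrow> f x"
      by simp
    have "norm (of_int \<lfloor>real (Suc n) * f x\<rfloor> / real (Suc n)) \<le> real C + 1" for n x
    proof -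
      have "1 / real (Suc n) \<le> 1" by simp
      then show ?thesis
        using floor_scaled_near[of n "f x"] C[of x] unfolding real_norm_def by linarith
    qed
    then show "AE x in P. norm (of_int \<lfloor>real (Suc n) * f x\<rfloor> / real (Suc n)) \<le> real C + 1" for n
      by (intro AE_I2)
    show "f \<in> borel_measurable P" "(\<lambda>x. of_int \<lfloor>real (Suc n) * f x\<rfloor> / real (Suc n)) \<in> borel_measurable P" for n
      by measurable
  qed simp
  then show ?thesis
    unfolding eq .
qed

lemma level_sum_tendsto_signed_integral:
  assumes f: "f \<in> borel_measurable borel" and C: "\<And>x. \<bar>f x\<bar> \<le> real C"
  shows "level_sum (smeasure \<nu>) f C \<longlonglongrightarrow> signed_integral \<nu> f"
proof -
  have "(\<lambda>n. level_sum (measure (pos_part \<nu>)) f C n - level_sum (measure (neg_part \<nu>)) f C n)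
      \<longlonglongrightarrow> signed_integral \<nu> f"
    unfolding signed_integral_def
    by (intro tendsto_diff level_sum_tendsto_integral f C finite_measure_pos_part finite_measure_neg_part) auto
  also have "(\<lambda>n. level_sum (measure (pos_part \<nu>)) f C n - level_sum (measure (neg_part \<nu>)) f C n)
      = level_sum (smeasure \<nu>) f C"
    unfolding level_sum_diff[symmetric]
    by (intro ext level_sum_cong[OF f]) (simp add: smeasure_eq_pos_minus_neg)
  finally show ?thesis .
qed

lemma bounded_range_nat_bound:
  fixes f :: "'a \<Rightarrow> real"
  assumes "bounded (range f)"
  obtains C where "\<And>x. \<bar>f x\<bar> \<le> real C"
proof -
  obtain B where "\<And>x. \<bar>f x\<bar> \<le> B"
    using assms by (auto simp: bounded_iff)
  moreover obtain C :: nat where "B \<le> real C"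
    using real_arch_simple by blast
  ultimately show ?thesis
    using that by (meson order_trans)
qed

text \<open>The Jordan parts of a difference are not the differences of the Jordan parts. Level sums
  see only the values of the measure and are linear in them, and they determine the integral as
  their limit.\<close>

lemma signed_integral_diff:
  assumes "f \<in> borel_measurable borel" "bounded (range f)"
  shows "signed_integral (\<mu> - \<nu>) f = signed_integral \<mu> f - signed_integral \<nu> f"
proof -
  obtain C where C: "\<And>x. \<bar>f x\<bar> \<le> real C"
    using bounded_range_nat_bound[OF assms(2)] by blast
  have "(\<lambda>n. level_sum (smeasure \<mu>) f C n - level_sum (smeasure \<nu>) f C n)
      \<longlonglongrightarrow> signed_integral \<mu> f - signed_integral \<nu> f"
    by (intro tendsto_diff level_sum_tendsto_signed_integral assms C)
  then have "level_sum (smeasure (\<mu> - \<nu>)) f C \<longlonglongrightarrow> signed_integral \<mu> f - signed_integral \<nu> f"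
    unfolding level_sum_diff[symmetric] smeasure_minus_apply[symmetric] .
  with level_sum_tendsto_signed_integral[OF assms(1) C] show ?thesis
    by (rule LIMSEQ_unique)
qed

lemma smeasure_signed_of:
  assumes "finite_measure P" "sets P = sets borel" "A \<in> sets borel"
  shows "smeasure (signed_of P) A = measure P A"
  using assms by transfer simp

text \<open>The Jordan parts of \<open>signed_of P\<close> are never computed: both integrals are
  limits of the same level sums.\<close>

lemma signed_integral_signed_of:
  assumes "finite_measure P" "sets P = sets borel" "f \<in> borel_measurable borel" "bounded (range f)"
  shows "signed_integral (signed_of P) f = integral\<^sup>L P f"
proof -
  obtain C where C: "\<And>x. \<bar>f x\<bar> \<le> real C"
    using bounded_range_nat_bound[OF assms(4)] by blast
  have "level_sum (smeasure (signed_of P)) f C = level_sum (measure P) f C"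
    by (intro ext level_sum_cong assms smeasure_signed_of)
  then show ?thesis
    using level_sum_tendsto_signed_integral[OF assms(3) C, of "signed_of P"]
      level_sum_tendsto_integral[OF assms(1-3) C] by (simp add: LIMSEQ_unique)
qed

lemma integrable_bounded_borel:
  fixes f :: "'a::topological_space \<Rightarrow> real"
  assumes "finite_measure P" "sets P = sets borel" "f \<in> borel_measurable borel" "bounded (range f)"
  shows "integrable P f"
proof -
  interpret finite_measure P by fact
  obtain B where "\<And>x. norm (f x) \<le> B"
    using assms(4) by (auto simp: bounded_iff)
  then show ?thesis
    using assms(3) measurable_cong_sets[OF assms(2) refl, of borel]
    by (intro integrable_const_bound[where B = B]) auto
qed

section \<open>Bounded sets and weakly closed sets of measures\<close>

lemma tv_bounded_measure_le:
  assumes "tv_bounded S"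
  obtains C where "C \<ge> 0" "\<And>\<nu>. \<nu> \<in> S \<Longrightarrow> measure (pos_part \<nu>) UNIV \<le> C"
    "\<And>\<nu>. \<nu> \<in> S \<Longrightarrow> measure (neg_part \<nu>) UNIV \<le> C"
proof -
  obtain C where C: "\<And>\<nu>. \<nu> \<in> S \<Longrightarrow> total_variation \<nu> \<le> ennreal C"
    using assms by (auto simp: tv_bounded_def)
  interpret P: finite_measure "pos_part \<nu>" for \<nu> :: "'a signed_measure"
    by (rule finite_measure_pos_part)
  interpret N: finite_measure "neg_part \<nu>" for \<nu> :: "'a signed_measure"
    by (rule finite_measure_neg_part)
  \<comment> \<open>The constant in \<open>tv_bounded\<close> may be negative, and
    \<open>ennreal\<close> then reads it as 0.\<close>
  have *: "measure (pos_part \<nu>) UNIV + measure (neg_part \<nu>) UNIV \<le> max C 0" if "\<nu> \<in> S" for \<nu>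
    using C[OF that] unfolding total_variation_def P.emeasure_eq_measure N.emeasure_eq_measure
    by (auto simp flip: ennreal_plus simp: ennreal_le_iff2)
  show ?thesis
  proof (rule that[of "max C 0"])
    show "measure (pos_part \<nu>) UNIV \<le> max C 0" if "\<nu> \<in> S" for \<nu>
      using *[OF that] measure_nonneg[of "neg_part \<nu>" UNIV] by linarith
    show "measure (neg_part \<nu>) UNIV \<le> max C 0" if "\<nu> \<in> S" for \<nu>
      using *[OF that] measure_nonneg[of "pos_part \<nu>" UNIV] by linarith
  qed simp
qed

text \<open>The open complement of \<open>S\<close> is generated from the subbasis by finite
  intersections and arbitrary unions. Induction on this generation shows that the sequence
  eventually enters every open set containing \<mu>.\<close>

lemma weakly_closed_sequentially:
  assumes S: "closedin weak_topology S" "\<And>k. \<nu> k \<in> S"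
    and lim: "\<And>f. continuous_on UNIV f \<Longrightarrow> (\<lambda>k. signed_integral (\<nu> k) f) \<longlonglongrightarrow> signed_integral \<mu> f"
  shows "\<mu> \<in> S"
proof (rule ccontr)
  let ?B = "{{\<nu>. signed_integral \<nu> f \<in> U} | f U. continuous_on (UNIV :: 'a set) f \<and> open U}"
  assume "\<mu> \<notin> S"
  have "UNIV \<in> ?B"
    by (auto intro!: exI[of _ "\<lambda>_. 0"] exI[of _ UNIV])
  then have "topspace (weak_topology :: 'a signed_measure topology) = UNIV"
    unfolding weak_topology_def topology_generated_by_topspace by blast
  then have "generate_topology_on ?B (- S)"
    using S(1) by (simp add: closedin_def weak_topology_def Compl_eq_Diff_UNIV openin_topology_generated_by_iff)
  then have "\<mu> \<in> - S \<longrightarrow> (\<forall>\<^sub>F k in sequentially. \<nu> k \<in> - S)"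
  proof induction
    case (Int a b)
    then show ?case by (auto intro: eventually_conj)
  next
    case (UN K)
    show ?case
    proof
      assume "\<mu> \<in> \<Union>K"
      then obtain X where "X \<in> K" "\<mu> \<in> X" by blast
      with UN(2) have "\<forall>\<^sub>F k in sequentially. \<nu> k \<in> X" by blast
      then show "\<forall>\<^sub>F k in sequentially. \<nu> k \<in> \<Union>K"
        by eventually_elim (use \<open>X \<in> K\<close> in blast)
    qed
  next
    case (Basis s)
    then obtain f U where s: "s = {\<nu>. signed_integral \<nu> f \<in> U}" and "continuous_on UNIV f" "open U"
      by blast
    then show ?case
      using topological_tendstoD[OF lim] by simp
  qed simp
  then show False
    using \<open>\<mu> \<notin> S\<close> S(2) by simp
qed

section \<open>Weak compactness by transport to the real line\<close>

text \<open>Helly's theorem concerns probability distributions on the line, so the measures are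
  normalized before they are moved by \<sigma>, and the masses \<open>c k\<close> are made to
  converge separately.\<close>

lemma weakly_convergent_subsequence:
  fixes p :: "real \<Rightarrow> 'a::topological_space" and \<sigma> :: "'a \<Rightarrow> real" and P :: "nat \<Rightarrow> 'a measure"
  assumes p: "continuous_on UNIV p" and \<sigma>: "\<sigma> \<in> borel_measurable borel" "\<And>x. \<sigma> x \<in> {0..1}"
    and p\<sigma>: "\<And>x. p (\<sigma> x) = x"
    and P: "\<And>k. finite_measure (P k)" "\<And>k. sets (P k) = sets borel" "\<And>k. measure (P k) UNIV \<le> C"
  obtains r Q where "strict_mono (r :: nat \<Rightarrow> nat)" "finite_measure Q" "sets Q = sets borel"
    "\<And>f. continuous_on UNIV f \<Longrightarrow> bounded (range f) \<Longrightarrow>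
      (\<lambda>k. integral\<^sup>L (P (r k)) f) \<longlonglongrightarrow> (integral\<^sup>L Q f :: real)"
proof -
  interpret P: finite_measure "P k" for k by (rule P)
  have spaceP: "space (P k) = UNIV" for k
    using sets_eq_imp_space_eq[OF P(2)] by simp
  define c where "c k = measure (P k) UNIV" for k
  have c_nonneg: "c k \<ge> 0" for k by (simp add: c_def)
  \<comment> \<open>A measure of mass 0 cannot be normalized; the point mass is a placeholder, which
    the factor \<open>c k\<close> removes again in \<open>int_R\<close>.\<close>
  define R where "R k = (if c k = 0 then return borel 0
    else distr (density (P k) (\<lambda>_. ennreal (1 / c k))) borel \<sigma>)" for k
  have \<sigma>m: "\<sigma> \<in> borel_measurable (P k)" for k
    using \<sigma>(1) measurable_cong_sets[OF P(2) refl] by blast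
  have meas_p: "p \<in> borel_measurable borel"
    by (rule borel_measurable_continuous_onI[OF p])
  have prob: "prob_space (R k)" for k
  proof (cases "c k = 0")
    case False
    have "prob_space (density (P k) (\<lambda>_. ennreal (1 / c k)))"
    proof
      have "emeasure (P k) UNIV = ennreal (c k)"
        by (simp add: c_def P.emeasure_eq_measure)
      moreover have "UNIV \<in> sets (P k)" by (simp add: P(2))
      ultimately show "emeasure (density (P k) (\<lambda>_. ennreal (1 / c k))) (space (density (P k) (\<lambda>_. ennreal (1 / c k)))) = 1"
        using False c_nonneg[of k] by (simp add: spaceP emeasure_density_const flip: ennreal_mult')
    qed
    then show ?thesis
      using False \<sigma>m[of k] by (simp add: R_def prob_space.prob_space_distr)
  qed (simp add: R_def prob_space_return)
  have dist: "real_distribution (R k)" for k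
    using prob[of k] by (auto simp: real_distribution_def real_distribution_axioms_def R_def)
  \<comment> \<open>Tightness is phrased with half-open intervals; this one contains
    \<open>{0..1}\<close>, hence carries all the mass whatever the tolerance.\<close>
  have mass: "measure (R k) {-1<..2} = 1" for k
  proof (cases "c k = 0")
    case False
    interpret R: prob_space "R k" by (rule prob)
    have "\<sigma> x \<in> {-1<..2}" for x using \<sigma>(2)[of x] by simp
    then have "\<sigma> -` {-1<..2} = UNIV" by blast
    then have "measure (R k) {-1<..2} = measure (R k) (space (R k))"
      using False \<sigma>m[of k] by (simp add: R_def measure_distr)
    then show ?thesis by (simp add: R.prob_space)
  qed (simp add: R_def measure_return)
  have int_R: "integral\<^sup>L (P k) f = c k * (LINT t|R k. f (p t))"
    if f: "f \<in> borel_measurable borel" for f :: "'a \<Rightarrow> real" and k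
  proof (cases "c k = 0")
    case True
    then have "AE x in P k. f x = 0"
      by (intro AE_I'[of UNIV]) (auto simp: c_def P.emeasure_eq_measure P(2) null_sets_def)
    then have "integral\<^sup>L (P k) f = 0"
      by (rule integral_eq_zero_AE)
    with True show ?thesis by simp
  next
    case False
    have fp: "(\<lambda>t. f (p t)) \<in> borel_measurable borel"
      using f meas_p by measurable
    have fm: "f \<in> borel_measurable (P k)"
      using f measurable_cong_sets[OF P(2) refl] by blast
    have "(LINT t|R k. f (p t)) = (LINT x|density (P k) (\<lambda>_. ennreal (1 / c k)). f x)"
      using False \<sigma>m[of k] fp by (simp add: R_def integral_distr p\<sigma>)
    also have "\<dots> = (LINT x|P k. (1 / c k) *\<^sub>R f x)"
      using fm c_nonneg by (subst integral_density) auto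
    finally show ?thesis using False by simp
  qed
  have "bounded (range c)"
    using c_nonneg P(3) by (auto simp: bounded_iff c_def)
  then obtain c' r0 where r0: "strict_mono (r0 :: nat \<Rightarrow> nat)" and "(c \<circ> r0) \<longlonglongrightarrow> c'"
    using bounded_imp_convergent_subsequence by blast
  have tight: "tight R"
    unfolding tight_def
  proof (intro conjI allI impI)
    show "\<exists>a b. a < b \<and> (\<forall>n. measure (R n) {a<..b} > 1 - \<epsilon>)" if "\<epsilon> > 0" for \<epsilon> :: real
      using that mass by (intro exI[of _ "-1"] exI[of _ 2]) auto
  qed (rule dist)
  obtain r1 L where r1: "strict_mono (r1 :: nat \<Rightarrow> nat)" and L: "real_distribution L"
    and conv: "weak_conv_m (R \<circ> r0 \<circ> r1) L"
    using tight_imp_convergent_subsubsequence[OF tight r0] by blast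
  interpret L: real_distribution L by (rule L)
  have c': "(\<lambda>k. c (r0 (r1 k))) \<longlonglongrightarrow> c'"
    using LIMSEQ_subseq_LIMSEQ[OF \<open>(c \<circ> r0) \<longlonglongrightarrow> c'\<close> r1] by (simp add: o_def)
  have c'_nonneg: "c' \<ge> 0"
    using c' by (rule LIMSEQ_le_const) (simp add: c_nonneg)
  \<comment> \<open>The limit distribution returns to the original space along \<open>p\<close>, and
    the limit mass undoes the normalization.\<close>
  define Q where "Q = density (distr L borel p) (\<lambda>_. ennreal c')"
  have pL: "p \<in> measurable L borel"
    using meas_p by simp
  interpret pL: prob_space "distr L borel p"
    by (rule L.prob_space_distr[OF pL])
  show thesis
  proof (rule that[of "r0 \<circ> r1" Q])
    show "strict_mono (r0 \<circ> r1)" using r0 r1 by (rule strict_mono_o)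
    show "sets Q = sets borel" by (simp add: Q_def)
    have "emeasure Q UNIV = ennreal c'"
      using pL.emeasure_space_1 by (simp add: Q_def emeasure_density_const)
    then show "finite_measure Q" by (intro finite_measureI) (simp add: Q_def)
    fix f :: "'a \<Rightarrow> real" assume f: "continuous_on UNIV f" "bounded (range f)"
    have fm: "f \<in> borel_measurable borel"
      by (rule borel_measurable_continuous_onI[OF f(1)])
    obtain B where B: "\<And>x. norm (f x) \<le> B" using f(2) by (auto simp: bounded_iff)
    have "continuous_on UNIV (\<lambda>t. f (p t))"
      by (rule continuous_on_compose2[OF f(1) p]) auto
    then have "(\<lambda>k. LINT t|(R \<circ> r0 \<circ> r1) k. f (p t)) \<longlonglongrightarrow> (LINT t|L. f (p t))"
      using B dist by (intro weak_conv_imp_integral_bdd_continuous_conv[OF _ L conv])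
        (auto simp: continuous_on_eq_continuous_at)
    then have "(\<lambda>k. c (r0 (r1 k)) * (LINT t|R (r0 (r1 k)). f (p t))) \<longlonglongrightarrow> c' * (LINT t|L. f (p t))"
      using c' by (intro tendsto_mult) (simp_all add: o_def)
    moreover have "integral\<^sup>L Q f = c' * (LINT t|L. f (p t))"
      unfolding Q_def using fm c'_nonneg pL by (subst integral_density) (auto simp: integral_distr)
    ultimately show "(\<lambda>k. integral\<^sup>L (P ((r0 \<circ> r1) k)) f) \<longlonglongrightarrow> integral\<^sup>L Q f"
      by (simp add: int_R[OF fm])
  qed
qed

lemma weakly_convergent_subsequence_signed:
  fixes p :: "real \<Rightarrow> 'a::topological_space" and \<sigma> :: "'a \<Rightarrow> real"
  assumes p: "continuous_on UNIV p" and \<sigma>: "\<sigma> \<in> borel_measurable borel" "\<And>x. \<sigma> x \<in> {0..1}"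
    and p\<sigma>: "\<And>x. p (\<sigma> x) = x"
    and S: "tv_bounded (S :: 'a signed_measure set)" "\<And>k. \<nu> k \<in> S"
  obtains r \<mu> where "strict_mono (r :: nat \<Rightarrow> nat)"
    "\<And>f. continuous_on UNIV f \<Longrightarrow> bounded (range f) \<Longrightarrow>
      (\<lambda>k. signed_integral (\<nu> (r k)) f) \<longlonglongrightarrow> signed_integral \<mu> f"
proof -
  obtain C where C: "\<And>k. measure (pos_part (\<nu> k)) UNIV \<le> C" "\<And>k. measure (neg_part (\<nu> k)) UNIV \<le> C"
    using tv_bounded_measure_le[OF S(1)] S(2) by metis
  obtain r P where r: "strict_mono (r :: nat \<Rightarrow> nat)" and P: "finite_measure P" "sets P = sets borel"
    and convP: "\<And>f. continuous_on UNIV f \<Longrightarrow> bounded (range f) \<Longrightarrow>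
      (\<lambda>k. integral\<^sup>L (pos_part (\<nu> (r k))) f) \<longlonglongrightarrow> (integral\<^sup>L P f :: real)"
    by (rule weakly_convergent_subsequence[OF p \<sigma> p\<sigma>, of "\<lambda>k. pos_part (\<nu> k)" C])
      (auto simp: finite_measure_pos_part C)
  obtain r' N where r': "strict_mono (r' :: nat \<Rightarrow> nat)" and N: "finite_measure N" "sets N = sets borel"
    and convN: "\<And>f. continuous_on UNIV f \<Longrightarrow> bounded (range f) \<Longrightarrow>
      (\<lambda>k. integral\<^sup>L (neg_part (\<nu> (r (r' k)))) f) \<longlonglongrightarrow> (integral\<^sup>L N f :: real)"
    by (rule weakly_convergent_subsequence[OF p \<sigma> p\<sigma>, of "\<lambda>k. neg_part (\<nu> (r k))" C])
      (auto simp: finite_measure_neg_part C)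
  show thesis
  \<comment> \<open>\<open>P\<close> and \<open>N\<close> need not be mutually singular, so the
    limit is given as a difference and its integral is found by linearity.\<close>
  proof (rule that[of "r \<circ> r'" "signed_of P - signed_of N"])
    show "strict_mono (r \<circ> r')" using r r' by (rule strict_mono_o)
    fix f :: "'a \<Rightarrow> real" assume f: "continuous_on UNIV f" "bounded (range f)"
    then have fm: "f \<in> borel_measurable borel"
      by (intro borel_measurable_continuous_onI)
    have "(\<lambda>k. integral\<^sup>L (pos_part (\<nu> (r (r' k)))) f) \<longlonglongrightarrow> integral\<^sup>L P f"
      using LIMSEQ_subseq_LIMSEQ[OF convP[OF f] r'] by (simp add: o_def)
    then have "(\<lambda>k. signed_integral (\<nu> (r (r' k))) f) \<longlonglongrightarrow> integral\<^sup>L P f - integral\<^sup>L N f"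
      unfolding signed_integral_def by (intro tendsto_diff convN f)
    then show "(\<lambda>k. signed_integral (\<nu> ((r \<circ> r') k)) f) \<longlonglongrightarrow> signed_integral (signed_of P - signed_of N) f"
      by (simp add: signed_integral_diff signed_integral_signed_of P N fm f)
  qed
qed

section \<open>A space-filling curve onto the torus\<close>

text \<open>A continuous function of period 2 that is 0 on \<open>{0..1/3}\<close> and 1 on
  \<open>{2/3..1}\<close>: the cosine equals 1/2 at pi/3 and -1/2 at 2 pi/3, so clamping produces
  these plateaus.\<close>

definition bump :: "real \<Rightarrow> real"
  where "bump t = max 0 (min 1 (1/2 - cos (pi * t)))"

lemma bump_bounds: "0 \<le> bump t" "bump t \<le> 1"
  by (auto simp: bump_def)

lemma continuous_on_bump: "continuous_on S bump"
  unfolding bump_def by (intro continuous_intros)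

lemma bump_add_even: "bump (2 * of_int k + t) = bump t"
proof -
  have "cos (pi * (2 * of_int k + t)) = cos (pi * t + 2 * pi * of_int k)"
    by (simp add: algebra_simps)
  also have "\<dots> = cos (pi * t)"
    by (simp add: cos_add cos_int_2pin sin_int_2pin)
  finally show ?thesis by (simp add: bump_def)
qed

lemma bump_left:
  assumes "0 \<le> t" "t \<le> 1/3"
  shows "bump t = 0"
proof -
  have "cos (pi / 3) \<le> cos (pi * t)"
    using assms by (intro cos_monotone_0_pi_le) (auto simp: field_simps)
  then show ?thesis by (simp add: bump_def cos_60)
qed

lemma bump_right:
  assumes "2/3 \<le> t" "t \<le> 1"
  shows "bump t = 1"
proof -
  have "cos (pi / 3) \<le> cos (pi * (1 - t))"
    using assms by (intro cos_monotone_0_pi_le) (auto simp: field_simps)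
  also have "\<dots> = - cos (pi * t)"
    by (simp add: right_diff_distrib cos_diff)
  finally show ?thesis by (simp add: bump_def cos_60)
qed

text \<open>The point of the Cantor set with ternary digits \<open>2 * a m\<close>. Without the
  digit 1, the leading digit decides between the two plateaus of \<open>bump\<close>.\<close>

definition cantor :: "(nat \<Rightarrow> real) \<Rightarrow> real"
  where "cantor a = (\<Sum>m. 2 * a m / 3 ^ Suc m)"

lemma summable_cantor:
  assumes "\<And>m. a m \<in> {0, 1::real}"
  shows "summable (\<lambda>m. 2 * a m / 3 ^ Suc m)"
proof (rule summable_comparison_test'[where N = 0])
  show "summable (\<lambda>m. (1/3::real) ^ m)" by (rule summable_geometric) simp
  show "norm (2 * a m / 3 ^ Suc m) \<le> (1/3) ^ m" for m
    using assms[of m] by (auto simp: power_one_over field_simps)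
qed

lemma cantor_bounds:
  assumes "\<And>m. a m \<in> {0, 1::real}"
  shows "cantor a \<in> {0..1}"
proof -
  have a: "0 \<le> a m" "a m \<le> 1" for m using assms[of m] by auto
  have sums: "(\<lambda>m. 2/3 * (1/3::real) ^ m) sums (2/3 * (1 / (1 - 1/3)))"
    by (intro sums_mult geometric_sums) simp
  have "cantor a \<le> (\<Sum>m. 2/3 * (1/3::real) ^ m)"
    unfolding cantor_def using a(2)
    by (intro suminf_le summable_cantor[OF assms] sums_summable[OF sums]) (simp add: power_one_over field_simps)
  also have "\<dots> = 1" using sums_unique[OF sums] by simp
  finally show ?thesis
    unfolding cantor_def using suminf_nonneg[OF summable_cantor[OF assms]] a(1) by simp
qed

lemma cantor_shift:
  assumes "\<And>m. a m \<in> {0, 1::real}"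
  shows "3 * cantor a = 2 * a 0 + cantor (\<lambda>m. a (Suc m))"
proof -
  have "cantor a = 2 * a 0 / 3 + (\<Sum>m. 2 * a (Suc m) / 3 ^ Suc (Suc m))"
    unfolding cantor_def using suminf_split_head[OF summable_cantor[of a, OF assms]] by simp
  also have "(\<Sum>m. 2 * a (Suc m) / 3 ^ Suc (Suc m)) = (\<Sum>m. 2 * a (Suc m) / 3 ^ Suc m / 3)"
    by (simp add: field_simps)
  also have "\<dots> = cantor (\<lambda>m. a (Suc m)) / 3"
    unfolding cantor_def by (rule suminf_divide) (rule summable_cantor[OF assms])
  finally show ?thesis by (simp add: field_simps)
qed

text \<open>Multiplication by 3 shifts the digits and splits off an even integer, which the period 2
  of \<open>bump\<close> absorbs. Once no shift is left, the leading digit selects the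
  plateau.\<close>

lemma bump_cantor:
  assumes "\<And>m. a m \<in> {0, 1::real}"
  shows "bump (3 ^ m * cantor a) = a m"
  using assms
proof (induction m arbitrary: a)
  case 0
  have "cantor (\<lambda>m. a (Suc m)) \<in> {0..1}" using 0 by (rule cantor_bounds)
  then show ?case
    using cantor_shift[of a, OF 0] 0[of 0] by (auto intro!: bump_left bump_right)
next
  case (Suc m)
  have "3 ^ Suc m * cantor a = 3 ^ m * (3 * cantor a)" by simp
  also have "\<dots> = 2 * (3 ^ m * a 0) + 3 ^ m * cantor (\<lambda>m. a (Suc m))"
    unfolding cantor_shift[of a, OF Suc.prems] by (simp add: algebra_simps)
  also have "3 ^ m * a 0 = of_int (3 ^ m * \<lfloor>a 0\<rfloor>)"
    using Suc.prems[of 0] by auto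
  finally show ?case
    using Suc.IH[of "\<lambda>m. a (Suc m)"] Suc.prems by (simp only: bump_add_even)
qed

section \<open>Binary expansions of fractional parts\<close>

definition digit :: "nat \<Rightarrow> real \<Rightarrow> real"
  where "digit n t = of_int (\<lfloor>2 ^ Suc n * t\<rfloor> - 2 * \<lfloor>2 ^ n * t\<rfloor>)"

lemma digit_cases: "digit n t \<in> {0, 1}"
proof -
  have "\<lfloor>2 ^ Suc n * t\<rfloor> = 2 * \<lfloor>2 ^ n * t\<rfloor> \<or> \<lfloor>2 ^ Suc n * t\<rfloor> = 2 * \<lfloor>2 ^ n * t\<rfloor> + 1"
    unfolding power_Suc mult.assoc by linarith
  then show ?thesis by (auto simp: digit_def)
qed

lemma digit_measurable [measurable]: "digit n \<in> borel_measurable borel"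
  unfolding digit_def by measurable

text \<open>Each term is the difference of two successive binary truncations of \<open>t\<close>, so
  the series telescopes from the floor of \<open>t\<close> up to \<open>t\<close>.\<close>

lemma digit_sums: "(\<lambda>n. digit n t / 2 ^ Suc n) sums frac t"
proof -
  have lim: "(\<lambda>n. of_int \<lfloor>2 ^ n * t\<rfloor> / 2 ^ n) \<longlonglongrightarrow> t"
  proof (rule LIM_zero_cancel, rule Lim_null_comparison[OF always_eventually], rule allI)
    fix n
    have "of_int \<lfloor>2 ^ n * t\<rfloor> / 2 ^ n - t = (of_int \<lfloor>2 ^ n * t\<rfloor> - 2 ^ n * t) / 2 ^ n"
      by (simp add: diff_divide_distrib)
    also have "norm \<dots> \<le> 1 / 2 ^ n"
      unfolding real_norm_def abs_divide power_abs abs_numeral by (rule divide_right_mono) (linarith, simp)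
    finally show "norm (of_int \<lfloor>2 ^ n * t\<rfloor> / 2 ^ n - t) \<le> (1/2) ^ n"
      by (simp add: power_one_over)
    show "(\<lambda>n. (1/2::real) ^ n) \<longlonglongrightarrow> 0" by (rule LIMSEQ_realpow_zero) auto
  qed
  from telescope_sums[OF lim] show ?thesis
    by (simp add: digit_def frac_def diff_divide_distrib)
qed

text \<open>Schoenberg's form of Lebesgue's space-filling curve.\<close>

definition schoenberg_curve :: "real \<Rightarrow> real ^ ('d::finite)"
  where "schoenberg_curve t = (\<chi> i. \<Sum>n. bump (3 ^ to_nat (i, n) * t) / 2 ^ Suc n)"

lemma continuous_on_schoenberg_curve: "continuous_on UNIV (schoenberg_curve :: real \<Rightarrow> real ^ ('d::finite))"
  unfolding schoenberg_curve_def
proof (intro continuous_on_vec_lambda)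
  fix i :: 'd
  have lim: "uniform_limit UNIV (\<lambda>m t. \<Sum>n<m. bump (3 ^ to_nat (i, n) * t) / 2 ^ Suc n)
      (\<lambda>t. \<Sum>n. bump (3 ^ to_nat (i, n) * t) / 2 ^ Suc n) sequentially"
  proof (rule Weierstrass_m_test)
    show "norm (bump (3 ^ to_nat (i, n) * t) / 2 ^ Suc n) \<le> (1/2) ^ n" for n t
      using bump_bounds[of "3 ^ to_nat (i, n) * t"] by (simp add: power_one_over field_simps)
  qed simp
  show "continuous_on UNIV (\<lambda>t. \<Sum>n. bump (3 ^ to_nat (i, n) * t) / 2 ^ Suc n)"
    by (rule uniform_limit_theorem[OF _ lim])
      (auto intro!: always_eventually continuous_intros continuous_on_compose2[OF continuous_on_bump[of UNIV]])
qed

section \<open>Fractional coordinates on the torus and the Borel section\<close>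

definition torus_coord :: "('d::finite) \<Rightarrow> 'd torus \<Rightarrow> real"
  where "torus_coord i x = frac (rep_torus x $ i)"

lemma to_torus_eq_iff: "to_torus x = to_torus y \<longleftrightarrow> (\<forall>i. x $ i - y $ i \<in> \<int>)"
  using Quotient3_rel[OF Quotient3_torus, of x y] by simp

lemma to_torus_rep_torus: "to_torus (rep_torus x) = x"
  by (rule Quotient3_abs_rep[OF Quotient3_torus])

text \<open>Two representatives of a point differ by integers, which \<open>frac\<close> ignores;
  the choice made by \<open>rep_torus\<close> is thus invisible.\<close>

lemma torus_coord_to_torus: "torus_coord i (to_torus y) = frac (y $ i)"
proof -
  have "rep_torus (to_torus y) $ i - y $ i \<in> \<int>"
    using to_torus_rep_torus[of "to_torus y"] unfolding to_torus_eq_iff by blast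
  then have "frac (y $ i + (rep_torus (to_torus y) $ i - y $ i)) = frac (y $ i)"
    by (rule frac_add_int_right)
  then show ?thesis by (simp add: torus_coord_def)
qed

lemma to_torus_torus_coord: "to_torus (\<chi> i. torus_coord i x) = x"
proof -
  have "to_torus (\<chi> i. torus_coord i x) = to_torus (rep_torus x)"
    unfolding to_torus_eq_iff by (auto simp: torus_coord_def frac_def)
  then show ?thesis by (simp add: to_torus_rep_torus)
qed

lemma open_frac_interval: "open {t::real. 0 < frac t \<and> frac t < a}"
proof -
  have "{t::real. 0 < frac t \<and> frac t < a} = (\<Union>k::int. {of_int k <..< of_int k + min a 1})"
  proof (intro set_eqI iffI)
    fix t :: real assume "t \<in> {t. 0 < frac t \<and> frac t < a}"
    then have "t \<in> {of_int \<lfloor>t\<rfloor> <..< of_int \<lfloor>t\<rfloor> + min a 1}"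
      using frac_lt_1[of t] by (auto simp: frac_def)
    then show "t \<in> (\<Union>k::int. {of_int k <..< of_int k + min a 1})" by blast
  next
    fix t :: real assume "t \<in> (\<Union>k::int. {of_int k <..< of_int k + min a 1})"
    then obtain k :: int where k: "of_int k < t" "t < of_int k + a" "t < of_int k + 1" by auto
    then have "\<lfloor>t\<rfloor> = k" by linarith
    then show "t \<in> {t. 0 < frac t \<and> frac t < a}" using k unfolding frac_def by simp
  qed
  then show ?thesis by auto
qed

text \<open>The coordinate jumps only where it vanishes. Away from that closed set its strict
  sublevel sets are open, by \<open>open_frac_interval\<close>.\<close>

lemma torus_coord_measurable [measurable]: "torus_coord i \<in> borel_measurable borel"
  unfolding borel_measurable_iff_less
proof
  fix a :: real
  have op: "open {x. 0 < torus_coord i x \<and> torus_coord i x < b}" for b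
  proof -
    have "open ((\<lambda>y. y $ i) -` {t. 0 < frac t \<and> frac t < b})"
      by (intro open_vimage open_frac_interval continuous_intros)
    then show ?thesis
      by (simp add: open_torus_def vimage_def torus_coord_to_torus)
  qed
  have "torus_coord i x < 1" for x by (simp add: torus_coord_def frac_lt_1)
  then have "open {x. 0 < torus_coord i x}" using op[of 1] by simp
  then have cl: "closed {x. torus_coord i x \<le> 0}" by (simp add: closed_def Compl_eq not_le)
  have "0 \<le> torus_coord i x" for x by (simp add: torus_coord_def)
  then have "{x. torus_coord i x < a}
      = (if 0 < a then {x. torus_coord i x \<le> 0} \<union> {x. 0 < torus_coord i x \<and> torus_coord i x < a} else {})"
    by (auto simp: not_less intro: order_trans)
  then show "{x \<in> space borel. torus_coord i x < a} \<in> sets borel"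
    using op[of a] cl by simp
qed

text \<open>The binary digits of all coordinates are interleaved into one Cantor point, in the
  positions from which \<open>schoenberg_curve\<close> reads them.\<close>

definition torus_section :: "('d::finite) torus \<Rightarrow> real"
  where "torus_section x = cantor (\<lambda>m. digit (snd (from_nat m :: 'd \<times> nat))
    (torus_coord (fst (from_nat m :: 'd \<times> nat)) x))"

lemma torus_section_bounds: "torus_section x \<in> {0..1}"
  unfolding torus_section_def by (intro cantor_bounds digit_cases)

lemma torus_section_measurable: "torus_section \<in> borel_measurable borel"
  unfolding torus_section_def cantor_def by measurable

text \<open>At scale \<open>3 ^ to_nat (i, n)\<close>, \<open>bump\<close> recovers the digit stored
  there, and the binary series reassembles each coordinate.\<close>

lemma schoenberg_torus_section: "to_torus (schoenberg_curve (torus_section x)) = x"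
proof -
  have "schoenberg_curve (torus_section x) $ i = torus_coord i x" for i
  proof -
    have "bump (3 ^ to_nat (i, n) * torus_section x) = digit n (torus_coord i x)" for n
      unfolding torus_section_def using bump_cantor[of "\<lambda>m. digit (snd (from_nat m :: 'a \<times> nat))
        (torus_coord (fst (from_nat m :: 'a \<times> nat)) x)" "to_nat (i, n)"] digit_cases by simp
    then have "schoenberg_curve (torus_section x) $ i = frac (torus_coord i x)"
      using sums_unique[OF digit_sums[of "torus_coord i x"]] by (simp add: schoenberg_curve_def)
    then show ?thesis by (simp add: torus_coord_def)
  qed
  then have "schoenberg_curve (torus_section x) = (\<chi> i. torus_coord i x)"
    by (simp add: vec_eq_iff)
  then show ?thesis by (simp add: to_torus_torus_coord)
qed

lemma continuous_on_to_torus_schoenberg: "continuous_on UNIV (\<lambda>t. to_torus (schoenberg_curve t))"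
  by (rule continuous_on_compose2[OF continuous_to_torus continuous_on_schoenberg_curve]) auto

text \<open>The curve maps \<open>{0..1}\<close> onto the torus, because the section takes its
  values there; so the range of \<open>f\<close> is covered by a continuous image of a compact
  interval.\<close>

lemma bounded_range_continuous_torus:
  fixes f :: "('d::finite) torus \<Rightarrow> real"
  assumes "continuous_on UNIV f"
  shows "bounded (range f)"
proof -
  let ?g = "\<lambda>t. f (to_torus (schoenberg_curve t))"
  have "continuous_on {0..1} ?g"
    using continuous_on_compose2[OF assms continuous_on_to_torus_schoenberg] by (auto intro: continuous_on_subset)
  then have "bounded (?g ` {0..1})"
    by (intro compact_imp_bounded compact_continuous_image) auto
  moreover have "range f \<subseteq> ?g ` {0..1}"
    using torus_section_bounds schoenberg_torus_section by (metis (no_types, lifting) image_iff image_subset_iff)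
  ultimately show ?thesis by (rule bounded_subset)
qed

lemma weakly_closed_tv_bounded_sequentially_compact:
  fixes S :: "('d::finite) torus signed_measure set"
  assumes S: "tv_bounded S" "closedin weak_topology S" "\<And>k. \<nu> k \<in> S"
  obtains r \<mu> where "strict_mono (r :: nat \<Rightarrow> nat)" "\<mu> \<in> S"
    "\<And>f. continuous_on UNIV f \<Longrightarrow> (\<lambda>k. signed_integral (\<nu> (r k)) f) \<longlonglongrightarrow> signed_integral \<mu> f"
proof -
  show thesis
  proof (rule weakly_convergent_subsequence_signed[OF continuous_on_to_torus_schoenberg
        torus_section_measurable torus_section_bounds schoenberg_torus_section S(1), of \<nu>])
    fix r :: "nat \<Rightarrow> nat" and \<mu> assume r: "strict_mono r"
      and conv: "\<And>f. continuous_on UNIV f \<Longrightarrow> bounded (range f) \<Longrightarrow>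
        (\<lambda>k. signed_integral (\<nu> (r k)) f) \<longlonglongrightarrow> signed_integral \<mu> f"
    have conv': "(\<lambda>k. signed_integral (\<nu> (r k)) f) \<longlonglongrightarrow> signed_integral \<mu> f"
      if "continuous_on UNIV f" for f
      by (rule conv[OF that bounded_range_continuous_torus[OF that]])
    have "\<mu> \<in> S"
      by (rule weakly_closed_sequentially[OF S(2), of "\<lambda>k. \<nu> (r k)"]) (rule S(3), rule conv')
    from that[OF r this conv'] show thesis .
  qed (rule S(3))
qed

section \<open>The convolution norm\<close>

lemma finite_measure_torus_volume: "finite_measure (torus_volume :: ('d::finite) torus measure)"
proof -
  let ?D = "{x :: real ^ 'd. \<forall>i. 0 \<le> x $ i \<and> x $ i < 1}"
  have D: "?D \<in> sets borel" by measurable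
  have "emeasure lborel ?D \<le> emeasure lborel (cbox 0 1 :: (real ^ 'd) set)"
    using D by (intro emeasure_mono) (auto simp: mem_box_cart less_imp_le)
  also have "\<dots> < \<infinity>" by (rule emeasure_lborel_cbox_finite)
  finally have "finite_measure (restrict_space lborel ?D)"
    using D by (intro finite_measureI) (simp add: emeasure_restrict_space space_restrict_space)
  moreover have "to_torus \<in> measurable (restrict_space lborel ?D) borel"
    using borel_measurable_continuous_onI[OF continuous_to_torus]
    by (intro measurable_restrict_space1) simp
  ultimately show ?thesis
    unfolding torus_volume_def by (rule finite_measure.finite_measure_distr)
qed

lemma sets_torus_volume [simp, measurable_cong]: "sets torus_volume = sets borel"
  by (simp add: torus_volume_def)

section \<open>Continuity on the quotient and of convolutions\<close>

lemma to_torus_diff: "to_torus (a - b) = to_torus a - to_torus b"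
  by (simp add: minus_torus.abs_eq)

text \<open>Universal property of the quotient topology. It moves continuity questions to real
  vectors, where sequences decide them and dominated convergence applies.\<close>

lemma continuous_on_torusI:
  fixes f :: "('d::finite) torus \<Rightarrow> 'b::topological_space"
  assumes "continuous_on UNIV (\<lambda>a. f (to_torus a))"
  shows "continuous_on UNIV f"
  using assms by (simp add: continuous_on_open_vimage open_torus_def vimage_def)

lemma continuous_torus_diff_left:
  assumes "continuous_on UNIV h"
  shows "continuous_on UNIV (\<lambda>x. h (x - y :: ('d::finite) torus))"
proof (rule continuous_on_torusI)
  have "continuous_on UNIV (\<lambda>a. h (to_torus (a - rep_torus y)))"
    by (intro continuous_on_compose2[OF assms] continuous_on_compose2[OF continuous_to_torus] continuous_intros) auto
  then show "continuous_on UNIV (\<lambda>a. h (to_torus a - y))"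
    by (simp add: to_torus_diff to_torus_rep_torus)
qed

lemma continuous_torus_diff_right:
  assumes "continuous_on UNIV h"
  shows "continuous_on UNIV (\<lambda>y. h (x - y :: ('d::finite) torus))"
proof (rule continuous_on_torusI)
  have "continuous_on UNIV (\<lambda>a. h (to_torus (rep_torus x - a)))"
    by (intro continuous_on_compose2[OF assms] continuous_on_compose2[OF continuous_to_torus] continuous_intros) auto
  then show "continuous_on UNIV (\<lambda>a. h (x - to_torus a))"
    by (simp add: to_torus_diff to_torus_rep_torus)
qed

lemma continuous_torus_convolution:
  fixes h :: "('d::finite) torus \<Rightarrow> real"
  assumes h: "continuous_on UNIV h" and P: "finite_measure P" "sets P = sets borel"
  shows "continuous_on UNIV (\<lambda>x. LINT y|P. h (x - y))"
proof (rule continuous_on_torusI, rule continuous_on_sequentiallyI)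
  fix u :: "nat \<Rightarrow> real ^ 'd" and a assume u: "u \<longlonglongrightarrow> a"
  obtain B where B: "\<And>x. norm (h x) \<le> B"
    using bounded_range_continuous_torus[OF h] by (auto simp: bounded_iff)
  have meas: "(\<lambda>y. h (x - y)) \<in> borel_measurable P" for x
    using borel_measurable_continuous_onI[OF continuous_torus_diff_right[OF h]]
      measurable_cong_sets[OF P(2) refl] by blast
  have "continuous_on UNIV (\<lambda>b. h (to_torus b - y))" for y
    by (intro continuous_on_compose2[OF continuous_torus_diff_left[OF h] continuous_to_torus]) auto
  then have "(\<lambda>n. h (to_torus (u n) - y)) \<longlonglongrightarrow> h (to_torus a - y)" for y
    by (rule continuous_on_tendsto_compose[OF _ u]) auto
  then show "(\<lambda>n. LINT y|P. h (to_torus (u n) - y)) \<longlonglongrightarrow> (LINT y|P. h (to_torus a - y))"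
    using finite_measure.integrable_const[OF P(1), of B] B meas
    by (intro integral_dominated_convergence[where w = "\<lambda>_. B"]) auto
qed

lemma continuous_signed_conv:
  assumes "continuous_on UNIV h"
  shows "continuous_on UNIV (signed_conv h \<mu>)"
  unfolding signed_conv_def signed_integral_def
  by (intro continuous_on_diff continuous_torus_convolution assms finite_measure_pos_part finite_measure_neg_part)
    auto

lemma signed_conv_diff:
  assumes "continuous_on UNIV h"
  shows "signed_conv h (\<mu> - \<nu>) x = signed_conv h \<mu> x - signed_conv h \<nu> x"
  unfolding signed_conv_def
  by (intro signed_integral_diff bounded_range_continuous_torus borel_measurable_continuous_onI
    continuous_torus_diff_right assms)

lemma abs_signed_integral_le:
  assumes f: "f \<in> borel_measurable borel" and B: "\<And>x. \<bar>f x\<bar> \<le> B"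
  shows "\<bar>signed_integral \<nu> f\<bar> \<le> B * measure (pos_part \<nu>) UNIV + B * measure (neg_part \<nu>) UNIV"
proof -
  have *: "\<bar>integral\<^sup>L P f\<bar> \<le> B * measure P UNIV"
    if P: "finite_measure P" "sets P = sets borel" for P
  proof -
    interpret finite_measure P by fact
    have f: "integrable P f"
      using B by (intro integrable_bounded_borel P f) (auto simp: bounded_iff)
    have "\<bar>integral\<^sup>L P f\<bar> \<le> (LINT x|P. \<bar>f x\<bar>)"
      by (rule integral_abs_bound)
    also have "\<dots> \<le> (LINT x|P. B)"
      using f B by (intro integral_mono) auto
    also have "\<dots> = B * measure P UNIV"
      using sets_eq_imp_space_eq[OF P(2)] by simp
    finally show ?thesis .
  qed
  show ?thesis
    unfolding signed_integral_def
    using *[OF finite_measure_pos_part[of \<nu>]] *[OF finite_measure_neg_part[of \<nu>]] by simp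
qed

text \<open>A weighted square inequality is integrated, with weights that make the right-hand side
  exactly the square of \<open>a + b\<close>. The padding by \<delta> / 2 keeps both divisors
  positive when a norm is 0.\<close>

lemma L2_triangle:
  fixes f g :: "'a \<Rightarrow> real"
  assumes [measurable]: "f \<in> borel_measurable M" "g \<in> borel_measurable M"
    and f: "integrable M (\<lambda>x. (f x)\<^sup>2)" and g: "integrable M (\<lambda>x. (g x)\<^sup>2)"
  shows "sqrt (LINT x|M. (f x + g x)\<^sup>2) \<le> sqrt (LINT x|M. (f x)\<^sup>2) + sqrt (LINT x|M. (g x)\<^sup>2)"
proof (rule field_le_epsilon)
  fix \<delta> :: real assume "\<delta> > 0"
  define a where "a = sqrt (LINT x|M. (f x)\<^sup>2) + \<delta> / 2"
  define b where "b = sqrt (LINT x|M. (g x)\<^sup>2) + \<delta> / 2"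
  have pos: "a > 0" "b > 0"
    using \<open>\<delta> > 0\<close> by (auto simp: a_def b_def intro!: add_nonneg_pos)
  have split: "(s + t)\<^sup>2 \<le> (1 + b / a) * s\<^sup>2 + (1 + a / b) * t\<^sup>2" for s t
  proof -
    have "0 \<le> (b * s - a * t)\<^sup>2 / (a * b)" using pos by simp
    also have "\<dots> = (1 + b / a) * s\<^sup>2 + (1 + a / b) * t\<^sup>2 - (s + t)\<^sup>2"
      using pos by (simp add: field_simps power2_eq_square)
    finally show ?thesis by simp
  qed
  have le_sq: "(LINT x|M. (f x)\<^sup>2) \<le> a\<^sup>2" "(LINT x|M. (g x)\<^sup>2) \<le> b\<^sup>2"
    using \<open>\<delta> > 0\<close> by (auto simp: a_def b_def intro!: sqrt_le_D)
  have int: "integrable M (\<lambda>x. (1 + b / a) * (f x)\<^sup>2 + (1 + a / b) * (g x)\<^sup>2)"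
    using f g by (intro Bochner_Integration.integrable_add integrable_mult_right)
  have "(LINT x|M. (f x + g x)\<^sup>2) \<le> (LINT x|M. (1 + b / a) * (f x)\<^sup>2 + (1 + a / b) * (g x)\<^sup>2)"
  proof (rule integral_mono[OF _ int split])
    show "integrable M (\<lambda>x. (f x + g x)\<^sup>2)"
      by (rule Bochner_Integration.integrable_bound[OF int]) (use split in \<open>auto intro: order_trans[OF _ abs_ge_self]\<close>)
  qed
  also have "\<dots> = (1 + b / a) * (LINT x|M. (f x)\<^sup>2) + (1 + a / b) * (LINT x|M. (g x)\<^sup>2)"
    using f g by (subst Bochner_Integration.integral_add) auto
  also have "\<dots> \<le> (1 + b / a) * a\<^sup>2 + (1 + a / b) * b\<^sup>2"
    using le_sq pos by (intro add_mono mult_left_mono) auto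
  also have "\<dots> = (a + b)\<^sup>2"
    using pos by (simp add: field_simps power2_eq_square)
  finally have "sqrt (LINT x|M. (f x + g x)\<^sup>2) \<le> a + b"
    using pos by (intro real_le_lsqrt) auto
  then show "sqrt (LINT x|M. (f x + g x)\<^sup>2)
      \<le> sqrt (LINT x|M. (f x)\<^sup>2) + sqrt (LINT x|M. (g x)\<^sup>2) + \<delta>"
    by (simp add: a_def b_def)
qed

lemma conv_norm_triangle:
  assumes h: "continuous_on UNIV h"
  shows "conv_norm h (\<mu> - \<rho>) \<le> conv_norm h (\<mu> - \<nu>) + conv_norm h (\<nu> - \<rho>)"
proof -
  have cont: "continuous_on UNIV (signed_conv h \<kappa>)" for \<kappa>
    by (rule continuous_signed_conv[OF h])
  have meas: "signed_conv h \<kappa> \<in> borel_measurable torus_volume" for \<kappa>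
    using borel_measurable_continuous_onI[OF cont] by simp
  have int: "integrable torus_volume (\<lambda>x. (signed_conv h \<kappa> x)\<^sup>2)" for \<kappa>
  proof (rule integrable_bounded_borel[OF finite_measure_torus_volume])
    have "continuous_on UNIV (\<lambda>x. (signed_conv h \<kappa> x)\<^sup>2)" by (intro continuous_intros cont)
    then show "(\<lambda>x. (signed_conv h \<kappa> x)\<^sup>2) \<in> borel_measurable borel" "bounded (range (\<lambda>x. (signed_conv h \<kappa> x)\<^sup>2))"
      by (auto intro: borel_measurable_continuous_onI bounded_range_continuous_torus)
  qed simp
  have "signed_conv h (\<mu> - \<rho>) x = signed_conv h (\<mu> - \<nu>) x + signed_conv h (\<nu> - \<rho>) x" for x
    by (simp add: signed_conv_diff[OF h])
  then show ?thesis
    using L2_triangle[OF meas meas int int, of "\<mu> - \<nu>" "\<nu> - \<rho>"] by (simp add: conv_norm_def torus_L2_norm_def)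
qed

lemma conv_norm_tendsto:
  assumes h: "continuous_on UNIV h" and S: "tv_bounded S" "\<And>k. \<nu> k \<in> S"
    and lim: "\<And>f. continuous_on UNIV f \<Longrightarrow> (\<lambda>k. signed_integral (\<nu> k) f) \<longlonglongrightarrow> signed_integral \<mu> f"
  shows "(\<lambda>k. conv_norm h (\<rho> - \<nu> k)) \<longlonglongrightarrow> conv_norm h (\<rho> - \<mu>)"
proof -
  obtain C where C: "C \<ge> 0" "\<And>k. measure (pos_part (\<nu> k)) UNIV \<le> C" "\<And>k. measure (neg_part (\<nu> k)) UNIV \<le> C"
    using tv_bounded_measure_le[OF S(1)] S(2) by metis
  obtain B where B: "\<And>x. \<bar>h x\<bar> \<le> B"
    using bounded_range_continuous_torus[OF h] by (auto simp: bounded_iff)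
  obtain K where K: "\<And>x. \<bar>signed_conv h \<rho> x\<bar> \<le> K"
    using bounded_range_continuous_torus[OF continuous_signed_conv[OF h]] by (auto simp: bounded_iff)
  have "B \<ge> 0" using B[of 0] by linarith
  \<comment> \<open>Boundedness in total variation makes this bound independent of \<open>k\<close>,
    which yields a constant dominating function on the finite volume of the torus.\<close>
  have bd: "\<bar>signed_conv h (\<nu> k) x\<bar> \<le> B * C + B * C" for k x
  proof -
    have "\<bar>signed_conv h (\<nu> k) x\<bar> \<le> B * measure (pos_part (\<nu> k)) UNIV + B * measure (neg_part (\<nu> k)) UNIV"
      unfolding signed_conv_def using B
      by (intro abs_signed_integral_le borel_measurable_continuous_onI continuous_torus_diff_right h)
    also have "\<dots> \<le> B * C + B * C"
      using C \<open>B \<ge> 0\<close> by (intro add_mono mult_left_mono)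
    finally show ?thesis .
  qed
  have meas: "(\<lambda>x. (signed_conv h \<kappa> x)\<^sup>2) \<in> borel_measurable torus_volume" for \<kappa>
    using borel_measurable_continuous_onI[OF continuous_signed_conv[OF h, of \<kappa>]] by simp
  have "(\<lambda>k. signed_conv h (\<nu> k) x) \<longlonglongrightarrow> signed_conv h \<mu> x" for x
    unfolding signed_conv_def by (intro lim continuous_torus_diff_right h)
  then have ptw: "(\<lambda>k. (signed_conv h (\<rho> - \<nu> k) x)\<^sup>2) \<longlonglongrightarrow> (signed_conv h (\<rho> - \<mu>) x)\<^sup>2" for x
    unfolding signed_conv_diff[OF h] by (intro tendsto_intros)
  have "\<bar>signed_conv h (\<rho> - \<nu> k) x\<bar> \<le> K + (B * C + B * C)" for k x
    unfolding signed_conv_diff[OF h] using K[of x] bd[of k x] by linarith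
  then have "norm ((signed_conv h (\<rho> - \<nu> k) x)\<^sup>2) \<le> (K + (B * C + B * C))\<^sup>2" for k x
    using power_mono[of "\<bar>signed_conv h (\<rho> - \<nu> k) x\<bar>" _ 2] by simp
  then have "(\<lambda>k. LINT x|torus_volume. (signed_conv h (\<rho> - \<nu> k) x)\<^sup>2)
      \<longlonglongrightarrow> (LINT x|torus_volume. (signed_conv h (\<rho> - \<mu>) x)\<^sup>2)"
    using ptw meas finite_measure.integrable_const[OF finite_measure_torus_volume]
    by (intro integral_dominated_convergence[where w = "\<lambda>_. (K + (B * C + B * C))\<^sup>2"]) auto
  then show ?thesis
    unfolding conv_norm_def torus_L2_norm_def by (rule tendsto_real_sqrt)
qed

text \<open>A sequence in \<open>S\<close> whose distances exceed \<epsilon> by less than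
  \<open>1 / real (Suc k)\<close> has a weak limit point in \<open>S\<close>, and the slack vanishes
  along the subsequence. The bound on the extended infimum also excludes an empty \<open>S\<close>,
  for which that infimum is infinite.\<close>

lemma conv_norm_nearest_point:
  fixes S :: "('d::finite) torus signed_measure set"
  assumes h: "continuous_on UNIV h" and S: "tv_bounded S" "closedin weak_topology S"
    and le: "(INF \<nu>\<in>S. ereal (conv_norm h (\<mu> - \<nu>))) \<le> ereal \<epsilon>"
  shows "\<exists>\<nu>\<in>S. conv_norm h (\<mu> - \<nu>) \<le> \<epsilon>"
proof -
  have "\<forall>k. \<exists>\<nu>. \<nu> \<in> S \<and> conv_norm h (\<mu> - \<nu>) < \<epsilon> + 1 / real (Suc k)"
  proof
    fix k
    have "(INF \<nu>\<in>S. ereal (conv_norm h (\<mu> - \<nu>))) < ereal (\<epsilon> + 1 / real (Suc k))"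
      using le by (rule le_less_trans) simp
    then show "\<exists>\<nu>. \<nu> \<in> S \<and> conv_norm h (\<mu> - \<nu>) < \<epsilon> + 1 / real (Suc k)"
      by (auto simp: INF_less_iff)
  qed
  from choice[OF this] obtain \<nu> where \<nu>: "\<And>k. \<nu> k \<in> S" "\<And>k. conv_norm h (\<mu> - \<nu> k) < \<epsilon> + 1 / real (Suc k)"
    by blast
  obtain r \<kappa> where r: "strict_mono (r :: nat \<Rightarrow> nat)" and "\<kappa> \<in> S"
    and lim: "\<And>f. continuous_on UNIV f \<Longrightarrow> (\<lambda>k. signed_integral (\<nu> (r k)) f) \<longlonglongrightarrow> signed_integral \<kappa> f"
    by (rule weakly_closed_tv_bounded_sequentially_compact[OF S, of \<nu>]) (rule \<nu>(1), rule that)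
  have "(\<lambda>k. conv_norm h (\<mu> - \<nu> (r k))) \<longlonglongrightarrow> conv_norm h (\<mu> - \<kappa>)"
    by (rule conv_norm_tendsto[OF h S(1) \<nu>(1) lim])
  moreover have "(\<lambda>k. \<epsilon> + 1 / real (Suc (r k))) \<longlonglongrightarrow> \<epsilon> + 0"
    using LIMSEQ_subseq_LIMSEQ[OF LIMSEQ_Suc[OF lim_1_over_n] r]
    by (intro tendsto_add tendsto_const) (simp add: o_def)
  ultimately have "conv_norm h (\<mu> - \<kappa>) \<le> \<epsilon> + 0"
    by (rule LIMSEQ_le) (use \<nu>(2) less_imp_le in blast)
  with \<open>\<kappa> \<in> S\<close> show ?thesis by auto
qed

theorem proposition8:
  fixes h :: "('d::finite) torus \<Rightarrow> real"
    and \<pi> :: "'d torus measure"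
    and A M :: "'d torus signed_measure set"
    and \<mu>' :: "'d torus signed_measure"
    and \<epsilon> :: real
  assumes "continuous_on UNIV h"
    and "\<And>\<xi>. torus_fourier h \<xi> \<noteq> 0"
    and "prob_space \<pi>" and "sets \<pi> = sets borel"
    and "A \<noteq> {}" and "tv_bounded A" and "closedin weak_topology A"
    and "M \<noteq> {}" and "tv_bounded M" and "closedin weak_topology M"
    and "hausdorff_distance (conv_norm h) A M \<le> ereal \<epsilon>"
    and "is_arg_min (\<lambda>\<mu>. conv_norm h (signed_of \<pi> - \<mu>)) (\<lambda>\<mu>. \<mu> \<in> A) \<mu>'"
  shows "\<exists>\<nu>\<in>M. conv_norm h (\<mu>' - \<nu>) \<le> \<epsilon> \<and>
           conv_norm h (signed_of \<pi> - \<nu>) \<le> (INF \<mu>\<in>M. conv_norm h (signed_of \<pi> - \<mu>)) + 2 * \<epsilon>"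
proof -
  note h = assms(1)
  have \<mu>': "\<mu>' \<in> A" and min: "\<And>\<mu>. \<mu> \<in> A \<Longrightarrow> conv_norm h (signed_of \<pi> - \<mu>') \<le> conv_norm h (signed_of \<pi> - \<mu>)"
    using assms(12) by (auto simp: is_arg_min_def not_less)
  have near_M: "(INF \<nu>\<in>M. ereal (conv_norm h (\<mu> - \<nu>))) \<le> ereal \<epsilon>" if "\<mu> \<in> A" for \<mu>
    using assms(11) that by (simp add: hausdorff_distance_def SUP_le_iff)
  have near_A: "(INF \<nu>\<in>A. ereal (conv_norm h (\<mu> - \<nu>))) \<le> ereal \<epsilon>" if "\<mu> \<in> M" for \<mu>
    using assms(11) that by (simp add: hausdorff_distance_def SUP_le_iff)
  obtain \<nu> where "\<nu> \<in> M" and \<nu>: "conv_norm h (\<mu>' - \<nu>) \<le> \<epsilon>"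
    using conv_norm_nearest_point[OF h assms(9,10) near_M[OF \<mu>']] by blast
  \<comment> \<open>Moving 2 \<epsilon> to the left leaves a lower bound for a real infimum, to be
    checked for each competitor \<mu>.\<close>
  have "conv_norm h (signed_of \<pi> - \<nu>) - 2 * \<epsilon> \<le> (INF \<mu>\<in>M. conv_norm h (signed_of \<pi> - \<mu>))"
  proof (rule cINF_greatest[OF assms(8)])
    fix \<mu> assume "\<mu> \<in> M"
    then obtain \<alpha> where "\<alpha> \<in> A" and \<alpha>: "conv_norm h (\<mu> - \<alpha>) \<le> \<epsilon>"
      using conv_norm_nearest_point[OF h assms(6,7) near_A] by blast
    \<comment> \<open>One \<epsilon> is spent between \<nu> and \<mu>', the other between \<mu> and
      its neighbour \<alpha>; in between, \<mu>' is no worse than \<alpha>.\<close>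
    have "conv_norm h (signed_of \<pi> - \<nu>) \<le> conv_norm h (signed_of \<pi> - \<mu>') + \<epsilon>"
      using conv_norm_triangle[OF h, of "signed_of \<pi>" \<nu> \<mu>'] \<nu> by linarith
    also have "\<dots> \<le> conv_norm h (signed_of \<pi> - \<alpha>) + \<epsilon>"
      using min[OF \<open>\<alpha> \<in> A\<close>] by simp
    also have "\<dots> \<le> conv_norm h (signed_of \<pi> - \<mu>) + \<epsilon> + \<epsilon>"
      using conv_norm_triangle[OF h, of "signed_of \<pi>" \<alpha> \<mu>] \<alpha> by linarith
    finally show "conv_norm h (signed_of \<pi> - \<nu>) - 2 * \<epsilon> \<le> conv_norm h (signed_of \<pi> - \<mu>)" by simp
  qed
  with \<open>\<nu> \<in> M\<close> \<nu> show ?thesis by (intro bexI[of _ \<nu>]) auto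
qed

end
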